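(* Let $N=\{N(\mathbf{s}),\ \mathbf{s}\in A\}$, $A\subset\mathbb{R}^d$, be the Poisson random field with underlying correlation $\rho(\mathbf{h})$ and constant mean function $\lambda(\mathbf{s})=\lambda>0$ for all $\mathbf{s}\in A$ (as defined in the context). Then $N$ is weakly stationary, and for all $\mathbf{s}_i,\mathbf{s}_j\in A$ with $\mathbf{h}=\mathbf{s}_i-\mathbf{s}_j$ and $|\rho(\mathbf{h})|<1$ its correlation function $\rho_N(\mathbf{h},\lambda)=\mathrm{Corr}(N(\mathbf{s}_i),N(\mathbf{s}_j))$ is given by $$\rho_N(\mathbf{h},\lambda)=\rho^2(\mathbf{h})\Big[1-\exp\big(-z(\mathbf{h},\lambda)\big)\Big(I_0\big(z(\mathbf{h},\lambda)\big)+I_1\big(z(\mathbf{h},\lambda)\big)\Big)\Big],$$ where $z(\mathbf{h},\lambda)=2\lambda\,(1-\rho^2(\mathbf{h}))^{-1}$.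
   Context: Let $A\subset\mathbb{R}^d$ and let $G=\{G(\mathbf{s}),\ \mathbf{s}\in A\}$ be a real-valued, zero-mean, unit-variance, weakly stationary Gaussian random field with correlation function $\rho(\mathbf{h})=\mathrm{Corr}(G(\mathbf{s}_i),G(\mathbf{s}_j))$, $\mathbf{h}=\mathbf{s}_i-\mathbf{s}_j$ (the "underlying correlation"). Let $\lambda(\mathbf{s})>0$ be a non-random function on $A$. With $G_1,G_2$ two independent copies of $G$, define the random field $$W(\mathbf{s})=\frac{1}{2\lambda(\mathbf{s})}\big(G_1^2(\mathbf{s})+G_2^2(\mathbf{s})\big),$$ which has exponential marginals with rate $\lambda(\mathbf{s})$ (mean $1/\lambda(\mathbf{s})$). Let $Y_1,Y_2,\ldots$ be an infinite sequence of independent copies of the random field $W$, and set $S_n(\mathbf{s})=\sum_{k=1}^n Y_k(\mathbf{s})$. The Poisson random field $N=\{N(\mathbf{s}),\ \mathbf{s}\in A\}$ with underlying correlation $\rho(\mathbf{h})$ and mean function $\lambda(\mathbf{s})$ is $$N(\mathbf{s})=\begin{cases}0 & \text{if } S_1(\mathbf{s})>1,\\ \max\{n\ge 1:\ S_n(\mathbf{s})\le 1\} & \text{if } S_1(\mathbf{s})\le 1,\end{cases}$$ (the common observation time is set to $t=1$). For each $\mathbf{s}$, $N(\mathbf{s})$ is Poisson distributed with mean $\lambda(\mathbf{s})$. $I_a(x)$ denotes the modified Bessel function of the first kind of order $a$. A random field is weakly stationary if it has finite second moments, constant mean, and a covariance between $\mathbf{s}_i$ and $\mathbf{s}_j$ that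 depends only on $\mathbf{s}_i-\mathbf{s}_j$. *)

theory Defs
  imports "HOL-Probability.Probability"
begin

text \<open>A random field on an index set \<open>A\<close> is a family \<open>X :: 'p \<Rightarrow> 'w \<Rightarrow> real\<close> of random variables
  of which only the members \<open>X s\<close> with \<open>s \<in> A\<close> matter.\<close>

definition random_field :: "'w measure \<Rightarrow> 'p set \<Rightarrow> ('p \<Rightarrow> 'w \<Rightarrow> real) \<Rightarrow> bool" where
  "random_field M A X \<longleftrightarrow> prob_space M \<and> (\<forall>s\<in>A. X s \<in> borel_measurable M)"

definition covariance :: "'w measure \<Rightarrow> ('w \<Rightarrow> real) \<Rightarrow> ('w \<Rightarrow> real) \<Rightarrow> real" where
  "covariance M X Y =
     integral\<^sup>L M (\<lambda>\<omega>. (X \<omega> - integral\<^sup>L M X) * (Y \<omega> - integral\<^sup>L M Y))"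

definition correlation :: "'w measure \<Rightarrow> ('w \<Rightarrow> real) \<Rightarrow> ('w \<Rightarrow> real) \<Rightarrow> real" where
  "correlation M X Y = covariance M X Y / sqrt (covariance M X X * covariance M Y Y)"

definition weakly_stationary ::
    "'w measure \<Rightarrow> 'p::ab_group_add set \<Rightarrow> ('p \<Rightarrow> 'w \<Rightarrow> real) \<Rightarrow> bool" where
  "weakly_stationary M A X \<longleftrightarrow>
     random_field M A X \<and>
     (\<forall>s\<in>A. integrable M (\<lambda>\<omega>. (X s \<omega>)\<^sup>2)) \<and>
     (\<exists>m. \<forall>s\<in>A. integral\<^sup>L M (X s) = m) \<and>
     (\<exists>C. \<forall>s\<in>A. \<forall>t\<in>A. covariance M (X s) (X t) = C (s - t))"

text \<open>Constants count as (degenerate) Gaussian variables; otherwise linear combinations of a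
  Gaussian field, such as \<open>G s - G t\<close> when the correlation is 1, would be excluded.\<close>

definition gaussian_rv :: "'w measure \<Rightarrow> ('w \<Rightarrow> real) \<Rightarrow> bool" where
  "gaussian_rv M X \<longleftrightarrow>
     X \<in> borel_measurable M \<and>
     ((\<exists>\<mu>. AE \<omega> in M. X \<omega> = \<mu>) \<or>
      (\<exists>\<mu> \<sigma>. \<sigma> > 0 \<and> distributed M lborel X (normal_density \<mu> \<sigma>)))"

definition gaussian_field :: "'w measure \<Rightarrow> 'p set \<Rightarrow> ('p \<Rightarrow> 'w \<Rightarrow> real) \<Rightarrow> bool" where
  "gaussian_field M A G \<longleftrightarrow>
     random_field M A G \<and>
     (\<forall>F c. finite F \<and> F \<subseteq> A \<longrightarrow> gaussian_rv M (\<lambda>\<omega>. \<Sum>s\<in>F. c s * G s \<omega>))"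

text \<open>The function \<open>\<rho>\<close> is constrained only at lags \<open>s - t\<close> with \<open>s, t \<in> A\<close>.\<close>

definition standard_gaussian_field ::
    "'w measure \<Rightarrow> 'p::ab_group_add set \<Rightarrow> ('p \<Rightarrow> real) \<Rightarrow> ('p \<Rightarrow> 'w \<Rightarrow> real) \<Rightarrow> bool" where
  "standard_gaussian_field M A \<rho> G \<longleftrightarrow>
     gaussian_field M A G \<and> weakly_stationary M A G \<and>
     (\<forall>s\<in>A. integral\<^sup>L M (G s) = 0 \<and> covariance M (G s) (G s) = 1) \<and>
     (\<forall>s\<in>A. \<forall>t\<in>A. correlation M (G s) (G t) = \<rho> (s - t))"

text \<open>Law of the field as a measure on \<open>A \<rightarrow> \<real>\<close> with the product sigma-algebra; two fields have the
  same law iff they have the same finite-dimensional distributions.\<close>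

definition field_law :: "'w measure \<Rightarrow> 'p set \<Rightarrow> ('p \<Rightarrow> 'w \<Rightarrow> real) \<Rightarrow> ('p \<Rightarrow> real) measure" where
  "field_law M A X = distr M (PiM A (\<lambda>_. borel)) (\<lambda>\<omega>. \<lambda>s\<in>A. X s \<omega>)"

text \<open>The fields \<open>X i\<close>, \<open>i \<in> I\<close>, on \<open>M\<close> are independent copies of the field \<open>Z\<close>, which may live on
  another probability space \<open>M'\<close>. Independence is that of whole fields, not pointwise in \<open>s\<close>.\<close>

definition independent_copies ::
    "'w measure \<Rightarrow> 'i set \<Rightarrow> 'p set \<Rightarrow> ('i \<Rightarrow> 'p \<Rightarrow> 'w \<Rightarrow> real) \<Rightarrow>
     'v measure \<Rightarrow> ('p \<Rightarrow> 'v \<Rightarrow> real) \<Rightarrow> bool" where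
  "independent_copies M I A X M' Z \<longleftrightarrow>
     random_field M' A Z \<and>
     (\<forall>i\<in>I. random_field M A (X i) \<and> field_law M A (X i) = field_law M' A Z) \<and>
     prob_space.indep_vars M (\<lambda>_. PiM A (\<lambda>_. borel)) (\<lambda>i \<omega>. \<lambda>s\<in>A. X i s \<omega>) I"

definition exponential_field ::
    "('p \<Rightarrow> real) \<Rightarrow> ('p \<Rightarrow> 'w \<Rightarrow> real) \<Rightarrow> ('p \<Rightarrow> 'w \<Rightarrow> real) \<Rightarrow> 'p \<Rightarrow> 'w \<Rightarrow> real" where
  "exponential_field rate G1 G2 s \<omega> = 1 / (2 * rate s) * ((G1 s \<omega>)\<^sup>2 + (G2 s \<omega>)\<^sup>2)"

definition renewal_sum :: "(nat \<Rightarrow> 'p \<Rightarrow> 'w \<Rightarrow> real) \<Rightarrow> nat \<Rightarrow> 'p \<Rightarrow> 'w \<Rightarrow> real" where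
  "renewal_sum Y n s \<omega> = (\<Sum>k=1..n. Y k s \<omega>)"

text \<open>For each \<open>s\<close> the set below is infinite only on a null event when \<open>Y\<close> is an i.i.d. sequence of
  exponential fields; there \<open>Max\<close> is an unspecified constant.\<close>

definition renewal_count :: "(nat \<Rightarrow> 'p \<Rightarrow> 'w \<Rightarrow> real) \<Rightarrow> 'p \<Rightarrow> 'w \<Rightarrow> nat" where
  "renewal_count Y s \<omega> =
     (if renewal_sum Y 1 s \<omega> > 1 then 0 else Max {n. n \<ge> 1 \<and> renewal_sum Y n s \<omega> \<le> 1})"

text \<open>\<open>N\<close>, on \<open>M\<close>, is the Poisson random field with underlying correlation \<open>\<rho>\<close> and mean function
  \<open>rate\<close>, built from a Gaussian field \<open>G\<close> on \<open>M0\<close>, independent copies \<open>GG 1\<close> and \<open>GG 2\<close> of \<open>G\<close> on \<open>M1\<close>,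
  and a sequence \<open>Y 1, Y 2, \<dots>\<close> on \<open>M\<close> of independent copies of the resulting exponential field.
  The three probability spaces may coincide.\<close>

definition poisson_random_field ::
    "'u measure \<Rightarrow> ('p \<Rightarrow> 'u \<Rightarrow> real) \<Rightarrow> 'v measure \<Rightarrow> (nat \<Rightarrow> 'p \<Rightarrow> 'v \<Rightarrow> real) \<Rightarrow>
     'w measure \<Rightarrow> (nat \<Rightarrow> 'p \<Rightarrow> 'w \<Rightarrow> real) \<Rightarrow>
     'p::ab_group_add set \<Rightarrow> ('p \<Rightarrow> real) \<Rightarrow> ('p \<Rightarrow> real) \<Rightarrow> ('p \<Rightarrow> 'w \<Rightarrow> nat) \<Rightarrow> bool" where
  "poisson_random_field M0 G M1 GG M Y A \<rho> rate N \<longleftrightarrow>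
     standard_gaussian_field M0 A \<rho> G \<and>
     (\<forall>s\<in>A. rate s > 0) \<and>
     independent_copies M1 {1, 2} A GG M0 G \<and>
     independent_copies M {1..} A Y M1 (exponential_field rate (GG 1) (GG 2)) \<and>
     (\<forall>s\<in>A. \<forall>\<omega>\<in>space M. N s \<omega> = renewal_count Y s \<omega>)"

text \<open>Modified Bessel function of the first kind of real order \<open>a\<close>, for argument \<open>x > 0\<close>
  (at \<open>x = 0\<close> the convention \<open>0 powr 0 = 0\<close> gives the wrong value for \<open>a = 0\<close>).
  Using \<open>rGamma\<close> makes terms at poles of the Gamma function vanish.\<close>

definition bessel_I :: "real \<Rightarrow> real \<Rightarrow> real" where
  "bessel_I a x = (\<Sum>k. (x / 2) powr (2 * real k + a) * rGamma (real k + a + 1) / fact k)"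

end

theory Submission
  imports Defs
begin

text \<open>Write \<open>r = \<rho>\<^sup>2\<close> and scale the increments by \<open>\<lambda>\<close>. The pair of increments at two sites has joint Laplace
  transform \<open>1 / ((1 + a) (1 + b) - r a b)\<close>, so the measure \<open>\<Sum>\<^sub>m\<^sub>n law (S\<^sub>m(s), S\<^sub>n(t))\<close>, whose mass on
  \<open>[0, \<lambda>]\<^sup>2\<close> is \<open>E (N(s) N(t))\<close>, has transform \<open>1 / (a b) + r / (a + b + (1 - r) a b)\<close> by geometric
  summation. The first term belongs to Lebesgue measure on the quadrant and accounts for
  \<open>E N(s) E N(t)\<close>. For \<open>r < 1\<close> the second one expands into a geometric series and belongs to
  \<open>r (1 - r) \<Sum>\<^sub>k \<Gamma>\<^sub>k \<otimes> \<Gamma>\<^sub>k\<close>, where \<open>\<Gamma>\<^sub>k\<close> is the Erlang law of shape \<open>k\<close> and rate \<open>1 / (1 - r)\<close>; for \<open>r = 1\<close>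
  it belongs to Lebesgue measure on the diagonal. Hence the covariance is \<open>r (1 - r)\<close> times the sum of
  the squared tails of a Poisson distribution of mean \<open>\<lambda> / (1 - r)\<close>, which summation by parts turns
  into Bessel functions. Since the transform depends on the sites only through \<open>r\<close>, so does the
  covariance.\<close>

section \<open>Joint Laplace transforms\<close>

text \<open>Two obstacles shape the argument. The double sum of laws has infinite total mass, so
  uniqueness of transforms for probability measures does not apply; and when
  \<open>|\<rho>| = 1\<close> the pair of sites has no joint density, so its law is handled through
  transforms alone. Arguments \<open>a, b > 0\<close> tame the infinite mass, and all that is read
  off from a transform is the mass of a square. The denominator is \<open>det (I + D S)\<close> with
  \<open>D = diag (a, b)\<close> and \<open>S\<close> the covariance matrix of the Gaussian pair:
  one Gaussian copy contributes the power -1/2, two independent copies the power -1. The splitting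
  of the summed transform comes from sorting index pairs by their smaller entry. With
  \<open>phi\<close> the transform of one pair of increments and
  \<open>q = 1 / phi - 1 = a + b + (1 - r) a b\<close>, the sum is
  \<open>(1 / q) (1 + 1 / a + 1 / b)\<close>; the bracket equals \<open>(q + r a b) / (a b)\<close>,
  which yields the product term and the remainder \<open>r / q\<close>.\<close>

definition exp_poly :: "nat \<Rightarrow> (nat \<Rightarrow> real) \<Rightarrow> real \<Rightarrow> real" where
  "exp_poly d a x = (\<Sum>i\<le>d. a i * exp (- (real (Suc i) * x)))"

lemma borel_measurable_exp_poly [measurable]: "exp_poly d a \<in> borel_measurable borel"
  unfolding exp_poly_def[abs_def] by measurable

text \<open>Substituting \<open>u = exp (- x)\<close> turns the indicator of
  \<open>x \<le> t\<close> into that of \<open>u \<ge> exp (- t)\<close>. The approximants must be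
  dominated by \<open>exp (- x)\<close> to be integrable against an infinite measure, so a factor
  \<open>u\<close> is split off and the Weierstrass theorem is applied to the quotient.\<close>

lemma exp_poly_approx_indicator:
  fixes t :: real
  assumes "t \<ge> 0"
  obtains a :: "nat \<Rightarrow> nat \<Rightarrow> real" and d :: "nat \<Rightarrow> nat" and B :: real
  where "\<And>n x. 0 \<le> x \<Longrightarrow> \<bar>exp_poly (d n) (a n) x\<bar> \<le> B * exp (- x)"
    and "\<And>x. 0 \<le> x \<Longrightarrow> (\<lambda>n. exp_poly (d n) (a n) x) \<longlonglongrightarrow> indicator {..t} x"
proof -
  define c where "c = exp (- t)"
  have c: "0 < c" "c \<le> 1" using assms by (auto simp: c_def)
  \<comment> \<open>A continuous version of \<open>indicator {c..} u / u\<close>. The ramp of slope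
    \<open>n\<close> lies below \<open>c\<close>, so the value at \<open>u = c\<close> is already
    right and the limit is the closed interval \<open>{..t}\<close>; \<open>max u c\<close> bounds
    the quotient by \<open>1 / c\<close>.\<close>
  define g where "g n u = max 0 (1 - real n * max 0 (c - u)) / max u c" for n and u :: real
  have cont: "continuous_on {0..1} (g n)" for n
    unfolding g_def using c by (auto intro!: continuous_intros)
  have g_nonneg: "0 \<le> g n u" for n u
    using c by (auto simp: g_def intro!: divide_nonneg_pos)
  have g_le: "g n u \<le> 1 / c" for n u
    unfolding g_def using c by (intro frac_le) auto
  have "\<exists>a d. \<forall>u\<in>{0..1}. \<bar>g n u - (\<Sum>i\<le>d. a i * u ^ i)\<bar> < 1 / real (Suc n)" for n
  proof -
    obtain p where p: "real_polynomial_function p"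
        "\<And>u. u \<in> {0..1} \<Longrightarrow> \<bar>g n u - p u\<bar> < 1 / real (Suc n)"
      using Stone_Weierstrass_real_polynomial_function[OF _ cont, of "1 / real (Suc n)"] by auto
    from p(1) obtain a d where "p = (\<lambda>u. \<Sum>i\<le>d. a i * u ^ i)"
      unfolding real_polynomial_function_iff_sum by blast
    with p(2) show ?thesis by blast
  qed
  then obtain a d where ad:
    "\<And>n u. u \<in> {0..1} \<Longrightarrow> \<bar>g n u - (\<Sum>i\<le>d n. a n i * u ^ i)\<bar> < 1 / real (Suc n)"
    by metis
  have exp_poly_eq: "exp_poly (d n) (a n) x = exp (- x) * (\<Sum>i\<le>d n. a n i * exp (- x) ^ i)" for n x
  proof -
    have "exp (- (real (Suc i) * x)) = exp (- x) ^ Suc i" for i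
      by (simp only: exp_of_nat_mult[symmetric] mult_minus_right)
    then show ?thesis by (simp add: exp_poly_def sum_distrib_left mult_ac)
  qed
  have near: "\<bar>exp (- x) * g n (exp (- x)) - exp_poly (d n) (a n) x\<bar> \<le> exp (- x) * (1 / real (Suc n))"
    if "0 \<le> x" for n x
  proof -
    have "\<bar>exp (- x) * g n (exp (- x)) - exp_poly (d n) (a n) x\<bar>
        = exp (- x) * \<bar>g n (exp (- x)) - (\<Sum>i\<le>d n. a n i * exp (- x) ^ i)\<bar>"
      unfolding exp_poly_eq right_diff_distrib[symmetric] abs_mult by simp
    also have "\<dots> \<le> exp (- x) * (1 / real (Suc n))"
      using ad[of "exp (- x)" n] that by (intro mult_left_mono) auto
    finally show ?thesis .
  qed
  show thesis
  proof (rule that)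
    fix n and x :: real assume x: "0 \<le> x"
    have "\<bar>exp_poly (d n) (a n) x\<bar> \<le> \<bar>exp (- x) * g n (exp (- x))\<bar> + exp (- x) * (1 / real (Suc n))"
      using near[OF x, of n] by linarith
    also have "\<dots> \<le> exp (- x) * (1 / c) + exp (- x) * 1"
      using g_nonneg[of n "exp (- x)"] g_le[of n "exp (- x)"]
      by (intro add_mono) (auto simp: abs_mult divide_inverse inverse_le_1_iff intro!: mult_left_mono)
    finally show "\<bar>exp_poly (d n) (a n) x\<bar> \<le> (1 / c + 1) * exp (- x)"
      by (simp add: algebra_simps)
  next
    fix x :: real assume x: "0 \<le> x"
    have "eventually (\<lambda>n. exp (- x) * g n (exp (- x)) = indicator {..t} x) sequentially"
    proof (cases "x \<le> t")
      case True
      then have "c \<le> exp (- x)" by (simp add: c_def)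
      then show ?thesis using True by (simp add: g_def)
    next
      case False
      then have "0 < c - exp (- x)" by (simp add: c_def)
      then obtain k :: nat where k: "1 < real k * (c - exp (- x))"
        using reals_Archimedean3 by blast
      have "exp (- x) * g n (exp (- x)) = indicator {..t} x" if "k \<le> n" for n
      proof -
        have "real k * (c - exp (- x)) \<le> real n * (c - exp (- x))"
          using that \<open>0 < c - exp (- x)\<close> by (intro mult_right_mono) auto
        with k have "1 < real n * (c - exp (- x))" by linarith
        then have "max 0 (1 - real n * max 0 (c - exp (- x))) = 0"
          using \<open>0 < c - exp (- x)\<close> by (simp add: max_def)
        with False show ?thesis by (simp add: g_def)
      qed
      then show ?thesis unfolding eventually_sequentially by blast
    qed
    then have lim: "(\<lambda>n. exp (- x) * g n (exp (- x))) \<longlonglongrightarrow> indicator {..t} x"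
      by (rule tendsto_eventually)
    have null: "(\<lambda>n. exp (- x) * inverse (real (Suc n))) \<longlonglongrightarrow> 0"
      by (rule tendsto_mult_right_zero[OF LIMSEQ_inverse_real_of_nat])
    have "(\<lambda>n. exp (- x) * g n (exp (- x)) - exp_poly (d n) (a n) x) \<longlonglongrightarrow> 0"
    proof (rule Lim_null_comparison[OF _ null], intro always_eventually allI)
      show "norm (exp (- x) * g n (exp (- x)) - exp_poly (d n) (a n) x)
          \<le> exp (- x) * inverse (real (Suc n))" for n
        using near[OF x, of n] unfolding real_norm_def inverse_eq_divide .
    qed
    from tendsto_diff[OF lim this] show "(\<lambda>n. exp_poly (d n) (a n) x) \<longlonglongrightarrow> indicator {..t} x"
      by simp
  qed
qed

text \<open>Stated for two functions on any measure, so that the sum of laws, measures on the plane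
  and a measure on the diagonal are all covered. The nonnegative integral allows infinite
  \<open>M\<close>; \<open>0 \<le> L a b\<close> keeps \<open>ennreal\<close> from truncating the
  value.\<close>

definition has_joint_laplace ::
    "'a measure \<Rightarrow> ('a \<Rightarrow> real) \<Rightarrow> ('a \<Rightarrow> real) \<Rightarrow> (real \<Rightarrow> real \<Rightarrow> real) \<Rightarrow> bool" where
  "has_joint_laplace M X Y L \<longleftrightarrow>
     X \<in> borel_measurable M \<and> Y \<in> borel_measurable M \<and>
     (AE \<omega> in M. 0 \<le> X \<omega> \<and> 0 \<le> Y \<omega>) \<and>
     (\<forall>a>0. \<forall>b>0. 0 \<le> L a b \<and>
        (\<integral>\<^sup>+\<omega>. ennreal (exp (- (a * X \<omega> + b * Y \<omega>))) \<partial>M) = ennreal (L a b))"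

text \<open>A Chernoff bound with both exponents 1. Since \<open>measure\<close> is 0 on sets of
  infinite mass, finiteness has to be known before \<open>measure\<close> can be converted back to
  \<open>emeasure\<close>.\<close>

lemma has_joint_laplace_square_finite:
  assumes "has_joint_laplace M X Y L"
  shows "emeasure M {\<omega> \<in> space M. X \<omega> \<le> t \<and> Y \<omega> \<le> t} < \<infinity>"
proof -
  have [measurable]: "X \<in> borel_measurable M" "Y \<in> borel_measurable M"
    using assms by (auto simp: has_joint_laplace_def)
  have "emeasure M {\<omega> \<in> space M. X \<omega> \<le> t \<and> Y \<omega> \<le> t}
      = (\<integral>\<^sup>+\<omega>. indicator {\<omega> \<in> space M. X \<omega> \<le> t \<and> Y \<omega> \<le> t} \<omega> \<partial>M)"
    by simp
  also have "\<dots> \<le> (\<integral>\<^sup>+\<omega>. ennreal (exp (2 * t)) * ennreal (exp (- (1 * X \<omega> + 1 * Y \<omega>))) \<partial>M)"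
  proof (intro nn_integral_mono)
    fix \<omega> assume "\<omega> \<in> space M"
    have "1 \<le> exp (2 * t) * exp (- (1 * X \<omega> + 1 * Y \<omega>))" if "X \<omega> \<le> t" "Y \<omega> \<le> t"
      using that by (simp add: exp_add[symmetric])
    then show "indicator {\<omega> \<in> space M. X \<omega> \<le> t \<and> Y \<omega> \<le> t} \<omega>
        \<le> ennreal (exp (2 * t)) * ennreal (exp (- (1 * X \<omega> + 1 * Y \<omega>)))"
      by (auto simp: indicator_def ennreal_mult''[symmetric] simp flip: ennreal_1 intro!: ennreal_leI)
  qed
  also have "\<dots> = ennreal (exp (2 * t)) * ennreal (L 1 1)"
  proof -
    have "(\<integral>\<^sup>+\<omega>. ennreal (exp (- (1 * X \<omega> + 1 * Y \<omega>))) \<partial>M) = ennreal (L 1 1)"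
      using assms unfolding has_joint_laplace_def by (metis zero_less_one)
    then show ?thesis by (simp add: nn_integral_cmult)
  qed
  also have "\<dots> < \<infinity>" by (simp add: ennreal_mult_less_top)
  finally show ?thesis .
qed

text \<open>A product of two approximants expands into exponentials at positive integer arguments,
  so the left-hand side sees the measure through \<open>L\<close> alone. The value at
  \<open>(1, 1)\<close> makes the dominating function integrable.\<close>

lemma has_joint_laplace_square_tendsto:
  assumes "has_joint_laplace M X Y L"
    and bound: "\<And>n x. 0 \<le> x \<Longrightarrow> \<bar>exp_poly (d n) (a n) x\<bar> \<le> B * exp (- x)"
    and lim: "\<And>x. 0 \<le> x \<Longrightarrow> (\<lambda>n. exp_poly (d n) (a n) x) \<longlonglongrightarrow> indicator {..t} x"
  shows "(\<lambda>n. \<Sum>i\<le>d n. \<Sum>j\<le>d n. a n i * a n j * L (real (Suc i)) (real (Suc j)))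
    \<longlonglongrightarrow> measure M {\<omega> \<in> space M. X \<omega> \<le> t \<and> Y \<omega> \<le> t}"
proof -
  have [measurable]: "X \<in> borel_measurable M" "Y \<in> borel_measurable M"
    and nonneg: "AE \<omega> in M. 0 \<le> X \<omega> \<and> 0 \<le> Y \<omega>"
    and L: "\<And>a b. 0 < a \<Longrightarrow> 0 < b \<Longrightarrow> 0 \<le> L a b"
      "\<And>a b. 0 < a \<Longrightarrow> 0 < b \<Longrightarrow>
        (\<integral>\<^sup>+\<omega>. ennreal (exp (- (a * X \<omega> + b * Y \<omega>))) \<partial>M) = ennreal (L a b)"
    using assms(1) by (auto simp: has_joint_laplace_def)
  have hbi: "has_bochner_integral M (\<lambda>\<omega>. exp (- (a * X \<omega> + b * Y \<omega>))) (L a b)"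
    if "0 < a" "0 < b" for a b
    using L[OF that] by (intro has_bochner_integral_nn_integral) auto
  have prod_eq: "exp_poly (d n) (a n) (X \<omega>) * exp_poly (d n) (a n) (Y \<omega>)
      = (\<Sum>i\<le>d n. \<Sum>j\<le>d n. a n i * a n j *
          exp (- (real (Suc i) * X \<omega> + real (Suc j) * Y \<omega>)))" for n \<omega>
    unfolding exp_poly_def sum_product by (simp add: exp_add exp_diff exp_minus field_simps)
  have "has_bochner_integral M (\<lambda>\<omega>. exp_poly (d n) (a n) (X \<omega>) * exp_poly (d n) (a n) (Y \<omega>))
      (\<Sum>i\<le>d n. \<Sum>j\<le>d n. a n i * a n j * L (real (Suc i)) (real (Suc j)))" for n
    unfolding prod_eq
    by (intro has_bochner_integral_sum has_bochner_integral_mult_right hbi) auto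
  then have eq: "(\<integral>\<omega>. exp_poly (d n) (a n) (X \<omega>) * exp_poly (d n) (a n) (Y \<omega>) \<partial>M)
      = (\<Sum>i\<le>d n. \<Sum>j\<le>d n. a n i * a n j * L (real (Suc i)) (real (Suc j)))" for n
    by (rule has_bochner_integral_integral_eq)
  have "(\<lambda>n. \<integral>\<omega>. exp_poly (d n) (a n) (X \<omega>) * exp_poly (d n) (a n) (Y \<omega>) \<partial>M)
      \<longlonglongrightarrow> (\<integral>\<omega>. indicator {..t} (X \<omega>) * indicator {..t} (Y \<omega>) \<partial>M)"
  proof (rule integral_dominated_convergence)
    show "integrable M (\<lambda>\<omega>. B * B * exp (- (1 * X \<omega> + 1 * Y \<omega>)))"
      using hbi[of 1 1] by (intro integrable_mult_right) (auto simp: has_bochner_integral_iff)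
    show "AE \<omega> in M. (\<lambda>n. exp_poly (d n) (a n) (X \<omega>) * exp_poly (d n) (a n) (Y \<omega>))
        \<longlonglongrightarrow> indicator {..t} (X \<omega>) * indicator {..t} (Y \<omega>)"
      using nonneg by eventually_elim (intro tendsto_mult lim; simp)
    show "AE \<omega> in M. norm (exp_poly (d n) (a n) (X \<omega>) * exp_poly (d n) (a n) (Y \<omega>))
        \<le> B * B * exp (- (1 * X \<omega> + 1 * Y \<omega>))" for n
      using nonneg
    proof eventually_elim
      fix \<omega> assume \<omega>: "0 \<le> X \<omega> \<and> 0 \<le> Y \<omega>"
      have "norm (exp_poly (d n) (a n) (X \<omega>) * exp_poly (d n) (a n) (Y \<omega>))
          \<le> (B * exp (- X \<omega>)) * (B * exp (- Y \<omega>))"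
        unfolding real_norm_def abs_mult using \<omega>
        by (intro mult_mono bound order_trans[OF abs_ge_zero bound]) auto
      also have "\<dots> = B * B * exp (- (1 * X \<omega> + 1 * Y \<omega>))"
        by (simp add: exp_add exp_minus exp_diff field_simps)
      finally show "norm (exp_poly (d n) (a n) (X \<omega>) * exp_poly (d n) (a n) (Y \<omega>))
          \<le> B * B * exp (- (1 * X \<omega> + 1 * Y \<omega>))" .
    qed
  qed measurable
  moreover have "(\<integral>\<omega>. indicator {..t} (X \<omega>) * indicator {..t} (Y \<omega>) \<partial>M)
      = measure M {\<omega> \<in> space M. X \<omega> \<le> t \<and> Y \<omega> \<le> t}"
  proof -
    have "(\<integral>\<omega>. indicator {..t} (X \<omega>) * indicator {..t} (Y \<omega>) \<partial>M)
       = (\<integral>\<omega>. indicator {\<omega> \<in> space M. X \<omega> \<le> t \<and> Y \<omega> \<le> t} \<omega> \<partial>M :: real)"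
      by (intro Bochner_Integration.integral_cong) (auto simp: indicator_def)
    then show ?thesis by simp
  qed
  ultimately show ?thesis unfolding eq by simp
qed

text \<open>On \<open>[0, \<infinity>)\<close> the indicator of \<open>[0, t]\<close> is a dominated limit of polynomials in
  \<open>exp (- x)\<close>, so the mass of the square \<open>[0, t]\<^sup>2\<close> is a limit of fixed linear combinations of values
  of the transform.\<close>

theorem has_joint_laplace_square_add:
  assumes "has_joint_laplace M X Y L" "has_joint_laplace M1 X1 Y1 L1" "has_joint_laplace M2 X2 Y2 L2"
    and L: "\<And>a b. 0 < a \<Longrightarrow> 0 < b \<Longrightarrow> L a b = L1 a b + c * L2 a b"
    and "0 \<le> t"
  shows "measure M {\<omega> \<in> space M. X \<omega> \<le> t \<and> Y \<omega> \<le> t}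
    = measure M1 {\<omega> \<in> space M1. X1 \<omega> \<le> t \<and> Y1 \<omega> \<le> t}
      + c * measure M2 {\<omega> \<in> space M2. X2 \<omega> \<le> t \<and> Y2 \<omega> \<le> t}"
proof -
  obtain a d B where
    ad: "\<And>n x. 0 \<le> x \<Longrightarrow> \<bar>exp_poly (d n) (a n) x\<bar> \<le> B * exp (- x)"
      "\<And>x. 0 \<le> x \<Longrightarrow> (\<lambda>n. exp_poly (d n) (a n) x) \<longlonglongrightarrow> indicator {..t} x"
    by (rule exp_poly_approx_indicator[OF \<open>0 \<le> t\<close>]) (rule that)
  define T where "T L n = (\<Sum>i\<le>d n. \<Sum>j\<le>d n. a n i * a n j * L (real (Suc i)) (real (Suc j)))"
    for L n
  have "T L n = T L1 n + c * T L2 n" for n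
    unfolding T_def sum_distrib_left sum.distrib[symmetric]
    by (intro sum.cong refl) (simp add: L algebra_simps del: of_nat_Suc)
  then have T_eq: "T L = (\<lambda>n. T L1 n + c * T L2 n)" by blast
  have lims: "T L \<longlonglongrightarrow> measure M {\<omega> \<in> space M. X \<omega> \<le> t \<and> Y \<omega> \<le> t}"
    "T L1 \<longlonglongrightarrow> measure M1 {\<omega> \<in> space M1. X1 \<omega> \<le> t \<and> Y1 \<omega> \<le> t}"
    "T L2 \<longlonglongrightarrow> measure M2 {\<omega> \<in> space M2. X2 \<omega> \<le> t \<and> Y2 \<omega> \<le> t}"
    unfolding T_def[abs_def]
    by (rule has_joint_laplace_square_tendsto[OF assms(1)] has_joint_laplace_square_tendsto[OF assms(2)]
          has_joint_laplace_square_tendsto[OF assms(3)]; erule ad)+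
  from lims(1) tendsto_add[OF lims(2) tendsto_mult_left[OF lims(3), of c]] show ?thesis
    unfolding T_eq by (rule LIMSEQ_unique)
qed

corollary has_joint_laplace_square_eq:
  assumes "has_joint_laplace M X Y L" "has_joint_laplace M' X' Y' L" "0 \<le> t"
  shows "measure M {\<omega> \<in> space M. X \<omega> \<le> t \<and> Y \<omega> \<le> t}
    = measure M' {\<omega> \<in> space M'. X' \<omega> \<le> t \<and> Y' \<omega> \<le> t}"
  by (rule has_joint_laplace_square_add[OF assms(1,2,2) _ assms(3), where c = 0, simplified])

section \<open>Squared Poisson tails and Bessel functions\<close>

definition poisson_mass :: "real \<Rightarrow> nat \<Rightarrow> real" where
  "poisson_mass \<mu> k = exp (- \<mu>) * \<mu> ^ k / fact k"

text \<open>The tail is strict, so index \<open>k\<close> belongs to the Erlang law of shape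
  \<open>k + 1\<close>, which is also the convention of \<open>erlang_CDF k\<close>.\<close>

definition poisson_tail :: "real \<Rightarrow> nat \<Rightarrow> real" where
  "poisson_tail \<mu> k = 1 - (\<Sum>n\<le>k. poisson_mass \<mu> n)"

lemma poisson_mass_nonneg: "0 \<le> \<mu> \<Longrightarrow> 0 \<le> poisson_mass \<mu> k"
  by (simp add: poisson_mass_def)

lemma poisson_mass_sums: "poisson_mass \<mu> sums 1"
proof -
  have "(\<lambda>k. exp (- \<mu>) * (\<mu> ^ k /\<^sub>R fact k)) sums (exp (- \<mu>) * exp \<mu>)"
    by (intro sums_mult exp_converges)
  moreover have "(\<lambda>k. exp (- \<mu>) * (\<mu> ^ k /\<^sub>R fact k)) = poisson_mass \<mu>"
    by (auto simp: poisson_mass_def divide_inverse scaleR_conv_of_real)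
  ultimately show ?thesis by (simp add: exp_minus)
qed

lemma poisson_mass_Suc: "real (Suc k) * poisson_mass \<mu> (Suc k) = \<mu> * poisson_mass \<mu> k"
  by (simp add: poisson_mass_def)

lemma poisson_tail_Suc: "poisson_tail \<mu> (Suc k) = poisson_tail \<mu> k - poisson_mass \<mu> (Suc k)"
  by (simp add: poisson_tail_def)

lemma poisson_tail_LIMSEQ: "poisson_tail \<mu> \<longlonglongrightarrow> 0"
proof -
  have "(\<lambda>k. 1 - (\<Sum>n\<le>k. poisson_mass \<mu> n)) \<longlonglongrightarrow> 1 - 1"
    using poisson_mass_sums[of \<mu>] unfolding sums_def_le by (intro tendsto_intros)
  then show ?thesis by (simp add: poisson_tail_def[abs_def])
qed

lemma poisson_tail_nonneg:
  assumes "0 \<le> \<mu>" shows "0 \<le> poisson_tail \<mu> k"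
  using sum_le_suminf[of "poisson_mass \<mu>" "{..k}"] poisson_mass_sums[of \<mu>] poisson_mass_nonneg[OF assms]
  by (auto simp: poisson_tail_def sums_iff)

text \<open>Markov's inequality for the event that a Poisson variable is at least
  \<open>k + 1\<close>, obtained termwise from the recursion of the masses. It controls the boundary
  term of the summation by parts.\<close>

lemma poisson_tail_le:
  assumes "0 \<le> \<mu>" shows "real (Suc k) * poisson_tail \<mu> k \<le> \<mu>"
proof -
  have tail: "(\<lambda>n. poisson_mass \<mu> (n + Suc k)) sums poisson_tail \<mu> k"
    using sums_split_initial_segment[OF poisson_mass_sums[of \<mu>], of "Suc k"]
    by (simp add: poisson_tail_def lessThan_Suc_atMost)
  have "real (Suc k) * poisson_tail \<mu> k \<le> \<mu> * (1 - (\<Sum>n<k. poisson_mass \<mu> n))"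
  proof (rule sums_le)
    show "(\<lambda>n. real (Suc k) * poisson_mass \<mu> (n + Suc k)) sums (real (Suc k) * poisson_tail \<mu> k)"
      by (intro sums_mult tail)
    show "(\<lambda>n. \<mu> * poisson_mass \<mu> (n + k)) sums (\<mu> * (1 - (\<Sum>n<k. poisson_mass \<mu> n)))"
      by (intro sums_mult sums_split_initial_segment poisson_mass_sums)
    fix n
    have "real (Suc k) * poisson_mass \<mu> (n + Suc k) \<le> real (Suc (n + k)) * poisson_mass \<mu> (Suc (n + k))"
      using poisson_mass_nonneg[OF assms] by (intro mult_mono) auto
    then show "real (Suc k) * poisson_mass \<mu> (n + Suc k) \<le> \<mu> * poisson_mass \<mu> (n + k)"
      unfolding poisson_mass_Suc .
  qed
  also have "\<dots> \<le> \<mu>"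
    using assms poisson_mass_nonneg[OF assms] by (intro mult_left_le) (auto intro: sum_nonneg)
  finally show ?thesis .
qed

text \<open>Summation by parts together with \<open>k \<pi>\<^sub>k = \<mu> \<pi>\<^sub>k\<^sub>-\<^sub>1\<close>, where \<open>\<pi>\<close> is the Poisson mass.\<close>
lemma sum_poisson_tail_squared:
  "(\<Sum>k\<le>K. (poisson_tail \<mu> k)\<^sup>2) =
     real (Suc K) * (poisson_tail \<mu> (Suc K))\<^sup>2
     + \<mu> * (1 - (poisson_tail \<mu> K)\<^sup>2 - (\<Sum>k\<le>K. (poisson_mass \<mu> k)\<^sup>2)
        - (\<Sum>k\<le>K. poisson_mass \<mu> k * poisson_mass \<mu> (Suc k)))"
proof -
  \<comment> \<open>Used with \<open>n = k + 1\<close>, \<open>p\<close> and \<open>q\<close> the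
    masses at \<open>k\<close> and \<open>k + 1\<close>, and \<open>R\<close> the tail at
    \<open>k\<close>: then \<open>R - q\<close> and \<open>R + p\<close> are the tails at
    \<open>k + 1\<close> and \<open>k - 1\<close>, and both differences telescope, starting from
    tail 1 at index -1.\<close>
  have step: "R\<^sup>2 = n * (R - q)\<^sup>2 - (n - 1) * R\<^sup>2 + \<mu> * ((R + p)\<^sup>2 - R\<^sup>2 - p\<^sup>2 - p * q)"
    if "n * q = \<mu> * p" for n p q R :: real
  proof -
    have "n * (R - q)\<^sup>2 = n * R\<^sup>2 - 2 * R * (n * q) + q * (n * q)"
      by (simp add: power2_eq_square algebra_simps)
    also have "\<dots> = n * R\<^sup>2 - 2 * R * (\<mu> * p) + q * (\<mu> * p)"
      by (simp only: that)
    finally show ?thesis by (simp add: power2_eq_square algebra_simps)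
  qed
  show ?thesis
  proof (induction K)
    case 0
    show ?case
      using step[OF poisson_mass_Suc[of 0 \<mu>], of "poisson_tail \<mu> 0"]
      by (simp add: poisson_tail_Suc) (simp add: poisson_tail_def)
  next
    case (Suc K)
    have R: "poisson_tail \<mu> K = poisson_tail \<mu> (Suc K) + poisson_mass \<mu> (Suc K)"
      by (simp add: poisson_tail_Suc)
    show ?case
      using Suc step[OF poisson_mass_Suc[of "Suc K" \<mu>], of "poisson_tail \<mu> (Suc K)"]
      unfolding R sum.atMost_Suc poisson_tail_Suc[of \<mu> "Suc K"] by (simp add: algebra_simps)
  qed
qed

text \<open>In the limit of the finite identity two series remain: the squared masses form the
  series of \<open>bessel_I 0\<close>, the products of neighbouring masses that of
  \<open>bessel_I 1\<close>. The argument is doubled because \<open>bessel_I\<close> expands in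
  \<open>x / 2\<close>.\<close>

lemma poisson_tail_squared_sums:
  assumes "0 < \<mu>"
  shows "(\<lambda>k. (poisson_tail \<mu> k)\<^sup>2) sums
    (\<mu> * (1 - exp (- (2 * \<mu>)) * (bessel_I 0 (2 * \<mu>) + bessel_I 1 (2 * \<mu>))))"
proof -
  note nonneg = poisson_mass_nonneg[OF less_imp_le[OF assms]] poisson_tail_nonneg[OF less_imp_le[OF assms]]
  have summable: "summable (poisson_mass \<mu>)"
    using poisson_mass_sums by (rule sums_summable)
  have le1: "poisson_mass \<mu> k \<le> 1" for k
    using sum_le_suminf[of "poisson_mass \<mu>" "{k}"] poisson_mass_sums[of \<mu>] nonneg
    by (auto simp: sums_iff)
  have sq: "summable (\<lambda>k. (poisson_mass \<mu> k)\<^sup>2)"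
    by (rule summable_comparison_test'[OF summable, of 0])
      (use nonneg le1 in \<open>auto simp: power2_eq_square intro: mult_left_le\<close>)
  have cross: "summable (\<lambda>k. poisson_mass \<mu> k * poisson_mass \<mu> (Suc k))"
    by (rule summable_comparison_test'[OF summable, of 0])
      (use nonneg le1 in \<open>auto intro: mult_left_le\<close>)
  have "(\<Sum>k. (poisson_mass \<mu> k)\<^sup>2) = exp (- (2 * \<mu>)) * bessel_I 0 (2 * \<mu>)"
  proof -
    have eq: "(poisson_mass \<mu> k)\<^sup>2 = exp (- (2 * \<mu>)) *
        ((2 * \<mu> / 2) powr (2 * real k + 0) * rGamma (real k + 0 + 1) / fact k)" for k
    proof -
      have "\<mu> powr (2 * real k) = \<mu> ^ (2 * k)"
        using assms powr_realpow[of \<mu> "2 * k"] by simp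
      moreover have "rGamma (real k + 1) = 1 / fact k"
        using Gamma_fact[of k] by (simp add: rGamma_inverse_Gamma add.commute divide_inverse)
      ultimately show ?thesis
        by (simp add: poisson_mass_def power2_eq_square power_mult mult_exp_exp power_mult_distrib)
    qed
    have "(\<lambda>k. (2 * \<mu> / 2) powr (2 * real k + 0) * rGamma (real k + 0 + 1) / fact k)
        = (\<lambda>k. exp (2 * \<mu>) * (poisson_mass \<mu> k)\<^sup>2)"
      unfolding eq by (simp add: mult.assoc[symmetric] mult_exp_exp)
    then have "bessel_I 0 (2 * \<mu>) = exp (2 * \<mu>) * (\<Sum>k. (poisson_mass \<mu> k)\<^sup>2)"
      unfolding bessel_I_def by (simp add: suminf_mult[OF sq])
    then show ?thesis by (simp add: mult.assoc[symmetric] mult_exp_exp)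
  qed
  moreover have "(\<Sum>k. poisson_mass \<mu> k * poisson_mass \<mu> (Suc k)) = exp (- (2 * \<mu>)) * bessel_I 1 (2 * \<mu>)"
  proof -
    have eq: "poisson_mass \<mu> k * poisson_mass \<mu> (Suc k) = exp (- (2 * \<mu>)) *
        ((2 * \<mu> / 2) powr (2 * real k + 1) * rGamma (real k + 1 + 1) / fact k)" for k
    proof -
      have "\<mu> powr (2 * real k + 1) = \<mu> ^ (2 * k + 1)"
        using assms powr_realpow[of \<mu> "2 * k + 1"] by (simp add: add.commute)
      moreover have "rGamma (real k + 1 + 1) = 1 / fact (Suc k)"
        using Gamma_fact[of "Suc k", where 'a=real] by (simp add: rGamma_inverse_Gamma add_ac divide_inverse del: fact_Suc)
      ultimately show ?thesis
        by (simp add: poisson_mass_def power_add mult_exp_exp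
            power_mult power2_eq_square power_mult_distrib mult_ac del: fact_Suc)
    qed
    have "(\<lambda>k. (2 * \<mu> / 2) powr (2 * real k + 1) * rGamma (real k + 1 + 1) / fact k)
        = (\<lambda>k. exp (2 * \<mu>) * (poisson_mass \<mu> k * poisson_mass \<mu> (Suc k)))"
      unfolding eq by (simp add: mult.assoc[symmetric] mult_exp_exp)
    then have "bessel_I 1 (2 * \<mu>) = exp (2 * \<mu>) * (\<Sum>k. poisson_mass \<mu> k * poisson_mass \<mu> (Suc k))"
      unfolding bessel_I_def by (simp add: suminf_mult[OF cross])
    then show ?thesis by (simp add: mult.assoc[symmetric] mult_exp_exp)
  qed
  \<comment> \<open>One tail factor absorbs the growing coefficient by Markov's inequality, the
    other tends to 0.\<close>
  moreover have "(\<lambda>K. real (Suc K) * (poisson_tail \<mu> (Suc K))\<^sup>2) \<longlonglongrightarrow> 0"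
  proof (rule Lim_null_comparison)
    show "eventually (\<lambda>K. norm (real (Suc K) * (poisson_tail \<mu> (Suc K))\<^sup>2) \<le> \<mu> * poisson_tail \<mu> (Suc K)) sequentially"
    proof (intro always_eventually allI)
      fix K
      have "real (Suc K) * poisson_tail \<mu> (Suc K) \<le> real (Suc (Suc K)) * poisson_tail \<mu> (Suc K)"
        using nonneg by (intro mult_right_mono) auto
      also have "\<dots> \<le> \<mu>" using assms by (intro poisson_tail_le) auto
      finally have "real (Suc K) * poisson_tail \<mu> (Suc K) * poisson_tail \<mu> (Suc K) \<le> \<mu> * poisson_tail \<mu> (Suc K)"
        using nonneg by (intro mult_right_mono) auto
      then show "norm (real (Suc K) * (poisson_tail \<mu> (Suc K))\<^sup>2) \<le> \<mu> * poisson_tail \<mu> (Suc K)"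
        using nonneg by (simp add: power2_eq_square mult.assoc)
    qed
    have "(\<lambda>K. \<mu> * poisson_tail \<mu> (Suc K)) \<longlonglongrightarrow> \<mu> * 0"
      by (intro tendsto_intros LIMSEQ_Suc poisson_tail_LIMSEQ)
    then show "(\<lambda>K. \<mu> * poisson_tail \<mu> (Suc K)) \<longlonglongrightarrow> 0" by simp
  qed
  then have "(\<lambda>K. \<Sum>k\<le>K. (poisson_tail \<mu> k)\<^sup>2) \<longlonglongrightarrow>
      0 + \<mu> * (1 - 0\<^sup>2 - (\<Sum>k. (poisson_mass \<mu> k)\<^sup>2) - (\<Sum>k. poisson_mass \<mu> k * poisson_mass \<mu> (Suc k)))"
    unfolding sum_poisson_tail_squared
    by (intro tendsto_intros poisson_tail_LIMSEQ summable_LIMSEQ' sq cross)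
  ultimately show ?thesis
    unfolding sums_def_le by (simp add: algebra_simps)
qed

text \<open>Arrival number \<open>k + 1\<close> of a Poisson process of rate \<open>l\<close> lies
  in \<open>[0, x]\<close> iff more than \<open>k\<close> points do.\<close>

lemma erlang_CDF_eq_poisson_tail: "0 \<le> x \<Longrightarrow> erlang_CDF k l x = poisson_tail (l * x) k"
  by (simp add: erlang_CDF_def poisson_tail_def poisson_mass_def mult.commute)

section \<open>Mixtures of product measures\<close>

text \<open>Exponential tilting: the weighted density is a multiple of the Erlang density of the
  same shape and rate \<open>l + a\<close>, whose total mass is obtained as its zeroth moment; hence
  the factor \<open>x ^ 0\<close>.\<close>

lemma nn_integral_erlang_density_exp:
  assumes "0 < l" "0 \<le> a"
  shows "(\<integral>\<^sup>+x. ennreal (erlang_density k l x) * ennreal (exp (- (a * x))) \<partial>lborel)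
    = ennreal ((l / (l + a)) ^ Suc k)"
proof -
  have "erlang_density k l x * exp (- (a * x)) = (l / (l + a)) ^ Suc k * (erlang_density k (l + a) x * x ^ 0)" for x
  proof -
    have "exp (- l * x) * exp (- (a * x)) = exp (- (l + a) * x)"
      by (simp add: mult_exp_exp algebra_simps)
    then show ?thesis
      using assms by (auto simp: erlang_density_def power_divide)
  qed
  then have "(\<integral>\<^sup>+x. ennreal (erlang_density k l x) * ennreal (exp (- (a * x))) \<partial>lborel)
      = (\<integral>\<^sup>+x. ennreal ((l / (l + a)) ^ Suc k) * ennreal (erlang_density k (l + a) x * x ^ 0) \<partial>lborel)"
    using assms by (simp add: ennreal_mult'' ennreal_mult' flip: ennreal_mult'' ennreal_mult')
  also have "\<dots> = ennreal ((l / (l + a)) ^ Suc k)"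
  proof -
    have "(\<integral>\<^sup>+x. ennreal (erlang_density k (l + a) x * x ^ 0) \<partial>lborel) = 1"
      using assms by (subst nn_integral_erlang_ith_moment) auto
    then show ?thesis by (subst nn_integral_cmult) auto
  qed
  finally show ?thesis .
qed

text \<open>The sum over \<open>k\<close> of the product of the measure with density
  \<open>e k\<close> with itself, kept as one density on the plane so that Tonelli reduces integrals
  of product functions to one dimension.\<close>

definition product_mixture :: "(nat \<Rightarrow> real \<Rightarrow> real) \<Rightarrow> (real \<times> real) measure" where
  "product_mixture e = density (lborel \<Otimes>\<^sub>M lborel) (\<lambda>z. \<Sum>k. ennreal (e k (fst z)) * ennreal (e k (snd z)))"

lemma nn_integral_product_mixture:
  assumes [measurable]: "\<And>k. e k \<in> borel_measurable borel"
    "f \<in> borel_measurable borel" "g \<in> borel_measurable borel"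
  shows "(\<integral>\<^sup>+z. f (fst z) * g (snd z) \<partial>product_mixture e)
    = (\<Sum>k. (\<integral>\<^sup>+x. ennreal (e k x) * f x \<partial>lborel) * (\<integral>\<^sup>+y. ennreal (e k y) * g y \<partial>lborel))"
proof -
  have [measurable]: "e k \<in> borel_measurable lborel" "f \<in> borel_measurable lborel"
    "g \<in> borel_measurable lborel" for k
    using assms by auto
  have factor: "(\<integral>\<^sup>+z. (ennreal (e k (fst z)) * f (fst z)) * (ennreal (e k (snd z)) * g (snd z))
          \<partial>(lborel \<Otimes>\<^sub>M lborel))
      = (\<integral>\<^sup>+x. ennreal (e k x) * f x \<partial>lborel) * (\<integral>\<^sup>+y. ennreal (e k y) * g y \<partial>lborel)" for k
    by (subst lborel.nn_integral_fst[symmetric]) (simp_all add: nn_integral_cmult nn_integral_multc)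
  have "(\<integral>\<^sup>+z. f (fst z) * g (snd z) \<partial>product_mixture e)
      = (\<integral>\<^sup>+z. (\<Sum>k. (ennreal (e k (fst z)) * f (fst z)) * (ennreal (e k (snd z)) * g (snd z)))
          \<partial>(lborel \<Otimes>\<^sub>M lborel))"
    unfolding product_mixture_def
    by (subst nn_integral_density)
      (auto intro!: nn_integral_cong simp: ennreal_suminf_multc[symmetric] mult_ac)
  also have "\<dots> = (\<Sum>k. \<integral>\<^sup>+z. (ennreal (e k (fst z)) * f (fst z)) * (ennreal (e k (snd z)) * g (snd z))
          \<partial>(lborel \<Otimes>\<^sub>M lborel))"
    by (intro nn_integral_suminf) measurable
  finally show ?thesis unfolding factor .
qed

lemma product_mixture_transform:
  assumes e [measurable]: "\<And>k. e k \<in> borel_measurable borel"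
    and supp: "\<And>k x. x < 0 \<Longrightarrow> e k x = 0"
    and m: "\<And>k a. 0 < a \<Longrightarrow> 0 \<le> m k a"
      "\<And>k a. 0 < a \<Longrightarrow> (\<integral>\<^sup>+x. ennreal (e k x) * ennreal (exp (- (a * x))) \<partial>lborel) = ennreal (m k a)"
    and L: "\<And>a b. 0 < a \<Longrightarrow> 0 < b \<Longrightarrow> (\<lambda>k. m k a * m k b) sums L a b"
  shows "has_joint_laplace (product_mixture e) fst snd L"
  unfolding has_joint_laplace_def
proof (intro conjI allI impI)
  show "fst \<in> borel_measurable (product_mixture e)" "snd \<in> borel_measurable (product_mixture e)"
    unfolding product_mixture_def by auto
  show "AE z in product_mixture e. 0 \<le> fst z \<and> 0 \<le> snd z"
    unfolding product_mixture_def
  proof (subst AE_density)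
    show "(\<lambda>z. \<Sum>k. ennreal (e k (fst z)) * ennreal (e k (snd z))) \<in> borel_measurable (lborel \<Otimes>\<^sub>M lborel)"
      by measurable
    have "(\<Sum>k. ennreal (e k (fst z)) * ennreal (e k (snd z))) = 0" if "fst z < 0 \<or> snd z < 0" for z
      using that supp by (auto simp: less_le)
    then show "AE z in lborel \<Otimes>\<^sub>M lborel. 0 < (\<Sum>k. ennreal (e k (fst z)) * ennreal (e k (snd z)))
        \<longrightarrow> 0 \<le> fst z \<and> 0 \<le> snd z"
      by (intro AE_I2) (metis less_irrefl not_le)
  qed
next
  fix a b :: real assume ab: "0 < a" "0 < b"
  show "0 \<le> L a b"
    using sums_le[OF _ sums_zero L[OF ab]] m(1) ab by simp
  have "(\<integral>\<^sup>+z. ennreal (exp (- (a * fst z + b * snd z))) \<partial>product_mixture e)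
      = (\<integral>\<^sup>+z. ennreal (exp (- (a * fst z))) * ennreal (exp (- (b * snd z))) \<partial>product_mixture e)"
    by (simp add: ennreal_mult'[symmetric] mult_exp_exp)
  also have "\<dots> = (\<Sum>k. ennreal (m k a) * ennreal (m k b))"
    by (subst nn_integral_product_mixture) (use m(2) ab in auto)
  also have "\<dots> = (\<Sum>k. ennreal (m k a * m k b))"
    using m(1) ab by (simp add: ennreal_mult)
  also have "\<dots> = ennreal (L a b)"
    using m(1) ab L by (intro suminf_ennreal_eq) auto
  finally show "(\<integral>\<^sup>+z. ennreal (exp (- (a * fst z + b * snd z))) \<partial>product_mixture e) = ennreal (L a b)" .
qed

lemma product_mixture_square:
  assumes e [measurable]: "\<And>k. e k \<in> borel_measurable borel"
    and q: "\<And>k. 0 \<le> q k"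
      "\<And>k. (\<integral>\<^sup>+x. ennreal (e k x) * indicator {..t} x \<partial>lborel) = ennreal (q k)"
    and Q: "(\<lambda>k. (q k)\<^sup>2) sums Q"
  shows "measure (product_mixture e) {z \<in> space (product_mixture e). fst z \<le> t \<and> snd z \<le> t} = Q"
proof -
  have [measurable]: "fst \<in> borel_measurable (product_mixture e)" "snd \<in> borel_measurable (product_mixture e)"
    unfolding product_mixture_def by auto
  have "emeasure (product_mixture e) {z \<in> space (product_mixture e). fst z \<le> t \<and> snd z \<le> t}
      = (\<integral>\<^sup>+z. indicator {z \<in> space (product_mixture e). fst z \<le> t \<and> snd z \<le> t} z \<partial>product_mixture e)"
    by (subst nn_integral_indicator) (auto intro!: borel_measurable_le)
  also have "\<dots> = (\<integral>\<^sup>+z. indicator {..t} (fst z) * indicator {..t} (snd z) \<partial>product_mixture e)"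
    by (intro nn_integral_cong) (auto simp: indicator_def)
  also have "\<dots> = (\<Sum>k. ennreal ((q k)\<^sup>2))"
    by (subst nn_integral_product_mixture) (auto simp: q power2_eq_square ennreal_mult)
  also have "\<dots> = ennreal Q"
    using Q by (intro suminf_ennreal_eq) auto
  finally show ?thesis
    using sums_le[OF _ sums_zero Q] by (simp add: measure_def)
qed

section \<open>Reference measures: the quadrant, the diagonal and the Erlang mixture\<close>

definition quadrant :: "(real \<times> real) measure" where
  "quadrant = product_mixture (\<lambda>k x. if k = 0 then indicator {0..} x else 0)"

lemma nn_integral_indicator_exp:
  assumes "0 < a"
  shows "(\<integral>\<^sup>+x. ennreal (indicator {0..} x) * ennreal (exp (- (a * x))) \<partial>lborel) = ennreal (1 / a)"
proof -
  have "ennreal (indicator {0..} x) * ennreal (exp (- (a * x))) = ennreal (1 / a) * ennreal (erlang_density 0 a x * x ^ 0)" for x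
    using assms by (auto simp: erlang_density_def indicator_def ennreal_mult''[symmetric])
  then have "(\<integral>\<^sup>+x. ennreal (indicator {0..} x) * ennreal (exp (- (a * x))) \<partial>lborel)
      = ennreal (1 / a) * (\<integral>\<^sup>+x. ennreal (erlang_density 0 a x * x ^ 0) \<partial>lborel)"
    by (simp add: nn_integral_cmult)
  then show ?thesis
    using assms by (simp only: nn_integral_erlang_ith_moment) simp
qed

lemma nn_integral_indicator_atMost:
  assumes "0 \<le> t"
  shows "(\<integral>\<^sup>+x. ennreal (indicator {0..} x) * indicator {..t} x \<partial>lborel) = ennreal t"
proof -
  have "(\<integral>\<^sup>+x. ennreal (indicator {0..} x) * indicator {..t} x \<partial>lborel)
      = (\<integral>\<^sup>+x. indicator {0..t} x \<partial>lborel)"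
    by (intro nn_integral_cong) (auto simp: indicator_def)
  then show ?thesis using assms by simp
qed

lemma quadrant_transform: "has_joint_laplace quadrant fst snd (\<lambda>a b. 1 / (a * b))"
  unfolding quadrant_def
proof (rule product_mixture_transform[where m = "\<lambda>k a. if k = 0 then 1 / a else 0"])
  fix a b :: real assume "0 < a" "0 < b"
  show "(\<lambda>k::nat. (if k = 0 then 1 / a else 0) * (if k = 0 then 1 / b else 0)) sums (1 / (a * b))"
    using sums_If_finite[of "\<lambda>k. k = (0::nat)" "\<lambda>_. 1 / (a * b)"]
    by (simp add: if_distrib if_distribR cong: if_cong)
qed (auto simp: nn_integral_indicator_exp)

lemma quadrant_square:
  assumes "0 \<le> t"
  shows "measure quadrant {z \<in> space quadrant. fst z \<le> t \<and> snd z \<le> t} = t\<^sup>2"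
  unfolding quadrant_def
proof (rule product_mixture_square[where q = "\<lambda>k. if k = 0 then t else 0"])
  show "(\<lambda>k::nat. (if k = 0 then t else 0)\<^sup>2) sums t\<^sup>2"
    using sums_If_finite[of "\<lambda>k. k = (0::nat)" "\<lambda>_. t\<^sup>2"]
    by (simp add: if_distrib if_distribR cong: if_cong)
qed (use assms in \<open>auto simp: nn_integral_indicator_atMost\<close>)

text \<open>With the identity as both coordinates this plays the part of Lebesgue measure on the
  diagonal. It serves twice: as the renewal measure of a single unit-rate process and as the
  remainder term for \<open>r = 1\<close>.\<close>

definition half_line :: "real measure" where
  "half_line = density lborel (\<lambda>x. ennreal (indicator {0..} x))"

lemma half_line_transform:
  "has_joint_laplace half_line (\<lambda>x. x) (\<lambda>x. x) (\<lambda>a b. 1 / (a + b))"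
  unfolding has_joint_laplace_def
proof (intro conjI allI impI)
  show "AE x in half_line. 0 \<le> x \<and> 0 \<le> x"
    unfolding half_line_def by (subst AE_density) (auto simp: indicator_def)
  fix a b :: real assume ab: "0 < a" "0 < b"
  have "(\<integral>\<^sup>+x. ennreal (exp (- (a * x + b * x))) \<partial>half_line)
      = (\<integral>\<^sup>+x. ennreal (indicator {0..} x) * ennreal (exp (- ((a + b) * x))) \<partial>lborel)"
    unfolding half_line_def by (subst nn_integral_density) (auto simp: distrib_right)
  then show "(\<integral>\<^sup>+x. ennreal (exp (- (a * x + b * x))) \<partial>half_line) = ennreal (1 / (a + b))"
    using ab by (simp only: nn_integral_indicator_exp add_pos_pos)
qed (auto simp: half_line_def)

lemma half_line_square:
  assumes "0 \<le> t"
  shows "measure half_line {x \<in> space half_line. x \<le> t \<and> x \<le> t} = t"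
proof -
  have "emeasure half_line {..t} = ennreal t"
    unfolding half_line_def using assms by (subst emeasure_density) (auto simp: nn_integral_indicator_atMost)
  moreover have "{x \<in> space half_line. x \<le> t \<and> x \<le> t} = {..t}"
    by (auto simp: half_line_def)
  ultimately show ?thesis using assms by (simp add: measure_def)
qed

definition erlang_mixture :: "real \<Rightarrow> (real \<times> real) measure" where
  "erlang_mixture l = product_mixture (\<lambda>k. erlang_density k l)"

lemma erlang_mixture_transform:
  assumes "0 < l"
  shows "has_joint_laplace (erlang_mixture l) fst snd (\<lambda>a b. l\<^sup>2 / (l * (a + b) + a * b))"
  unfolding erlang_mixture_def
proof (rule product_mixture_transform[where m = "\<lambda>k a. (l / (l + a)) ^ Suc k"])
  fix a b :: real assume ab: "0 < a" "0 < b"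
  \<comment> \<open>The common ratio of the series: one more Erlang stage multiplies the two
    one-dimensional transforms by \<open>l / (l + a)\<close> and \<open>l / (l + b)\<close>.\<close>
  define c where "c = l / (l + a) * (l / (l + b))"
  have "0 < (l + a) * (l + b) - l * l" using ab assms by (simp add: algebra_simps add_pos_pos)
  then have c: "0 < c" "c < 1"
    using ab assms by (auto simp: c_def)
  have "(\<lambda>k. c * c ^ k) sums (c * (1 / (1 - c)))"
    using c by (intro sums_mult geometric_sums) auto
  moreover have "c * (1 / (1 - c)) = l\<^sup>2 / (l * (a + b) + a * b)"
  proof -
    have "1 - c = (l * (a + b) + a * b) / ((l + a) * (l + b))"
      using ab assms by (simp add: c_def divide_simps) (simp add: algebra_simps)
    then show ?thesis
      using ab assms by (simp add: c_def power2_eq_square)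
  qed
  moreover have "(l / (l + a)) ^ Suc k * (l / (l + b)) ^ Suc k = c * c ^ k" for k
    unfolding power_mult_distrib[symmetric] c_def by simp
  ultimately show "(\<lambda>k. (l / (l + a)) ^ Suc k * (l / (l + b)) ^ Suc k) sums (l\<^sup>2 / (l * (a + b) + a * b))"
    by simp
next
  show "erlang_density k l x = 0" if "x < 0" for k x
    using that by (simp add: erlang_density_def)
qed (use assms in \<open>auto simp: nn_integral_erlang_density_exp simp del: power_Suc\<close>)

text \<open>Each Erlang law gives \<open>[0, t]\<close> the mass of a Poisson tail of mean
  \<open>l * t\<close>, so the square carries the sum of the squared tails.\<close>

lemma erlang_mixture_square:
  assumes "0 < l" "0 < t"
  shows "measure (erlang_mixture l) {z \<in> space (erlang_mixture l). fst z \<le> t \<and> snd z \<le> t}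
    = l * t * (1 - exp (- (2 * (l * t))) * (bessel_I 0 (2 * (l * t)) + bessel_I 1 (2 * (l * t))))"
  unfolding erlang_mixture_def
proof (rule product_mixture_square[where q = "\<lambda>k. erlang_CDF k l t"])
  show "(\<lambda>k. (erlang_CDF k l t)\<^sup>2) sums
      (l * t * (1 - exp (- (2 * (l * t))) * (bessel_I 0 (2 * (l * t)) + bessel_I 1 (2 * (l * t)))))"
    using poisson_tail_squared_sums[of "l * t"] assms by (simp add: erlang_CDF_eq_poisson_tail)
qed (use assms in \<open>auto simp: nn_integral_erlang_density\<close>)

section \<open>Laplace transforms of Gaussian pairs\<close>

text \<open>Completing the square turns the weighted density into the constant \<open>K\<close>
  times the normal density with mean \<open>- c / (1 + b)\<close> and variance
  \<open>1 / (1 + b)\<close>.\<close>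

lemma has_bochner_integral_std_normal_exp_quadratic:
  fixes b c :: real
  assumes "0 \<le> b"
  shows "has_bochner_integral std_normal_distribution (\<lambda>x. exp (- (b * x\<^sup>2 / 2) - c * x))
    (exp (c\<^sup>2 / (2 * (1 + b))) / sqrt (1 + b))"
proof (rule has_bochner_integral_density)
  define m s where "m = - c / (1 + b)" and "s = 1 / sqrt (1 + b)"
  define K where "K = exp (c\<^sup>2 / (2 * (1 + b))) / sqrt (1 + b)"
  have b: "0 < 1 + b" using assms by simp
  have s: "0 < s" "s\<^sup>2 = 1 / (1 + b)"
    using b by (auto simp: s_def power_divide)
  have eq: "std_normal_density x *\<^sub>R exp (- (b * x\<^sup>2 / 2) - c * x) = K * normal_density m s x" for x
  proof -
    have "- x\<^sup>2 / 2 + (- (b * x\<^sup>2 / 2) - c * x) = c\<^sup>2 / (2 * (1 + b)) + - (x - m)\<^sup>2 / (2 * s\<^sup>2)"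
    proof -
      define B where "B = 1 + b"
      have "0 < B" "b = B - 1" using b by (auto simp: B_def)
      have "B * (x - m)\<^sup>2 = B * x\<^sup>2 + 2 * c * x + c\<^sup>2 / B"
        using \<open>0 < B\<close> by (simp add: m_def B_def[symmetric] power2_eq_square field_simps)
      moreover have "(x - m)\<^sup>2 / (2 * s\<^sup>2) = B * (x - m)\<^sup>2 / 2"
        unfolding s(2) B_def by simp
      ultimately show ?thesis
        unfolding B_def[symmetric] \<open>b = B - 1\<close> by (simp add: algebra_simps add_divide_distrib diff_divide_distrib)
    qed
    then have "exp (- x\<^sup>2 / 2) * exp (- (b * x\<^sup>2 / 2) - c * x)
        = exp (c\<^sup>2 / (2 * (1 + b))) * exp (- (x - m)\<^sup>2 / (2 * s\<^sup>2))"
      unfolding exp_add[symmetric] by simp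
    moreover have "1 / sqrt (2 * pi * s\<^sup>2) = sqrt (1 + b) / sqrt (2 * pi)"
      unfolding s(2) using b by (simp add: real_sqrt_mult real_sqrt_divide)
    ultimately show ?thesis
      unfolding std_normal_density_def normal_density_def K_def using b by simp
  qed
  have "has_bochner_integral lborel (normal_density m s) 1"
    using s by (simp add: has_bochner_integral_iff)
  then have "has_bochner_integral lborel (\<lambda>x. K * normal_density m s x) (K * 1)"
    by (intro has_bochner_integral_mult_right) auto
  then show "has_bochner_integral lborel (\<lambda>x. std_normal_density x *\<^sub>R exp (- (b * x\<^sup>2 / 2) - c * x))
      (exp (c\<^sup>2 / (2 * (1 + b))) / sqrt (1 + b))"
    unfolding eq K_def by simp
qed auto

lemma integral_std_normal_cos:
  "(\<integral>x. cos (t * x) \<partial>std_normal_distribution) = exp (- t\<^sup>2 / 2)"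
proof -
  interpret real_distribution std_normal_distribution by (rule real_dist_normal_dist)
  have "integrable std_normal_distribution (\<lambda>x. iexp (t * x))"
    by (intro integrable_iexp) auto
  then have "(\<integral>x. Re (iexp (t * x)) \<partial>std_normal_distribution) = Re (char std_normal_distribution t)"
    unfolding char_def by (rule integral_Re)
  then show ?thesis by (simp add: char_std_normal_distribution Re_exp)
qed

text \<open>A constant with mean 0 is 0, so the degenerate case has \<open>q = 0\<close> and obeys
  the same formula; otherwise rescaling leads to the real part of the standard normal characteristic
  function.\<close>

lemma (in prob_space) gaussian_rv_expectation_cos:
  assumes "gaussian_rv M Z" "expectation Z = 0" "expectation (\<lambda>\<omega>. (Z \<omega>)\<^sup>2) = q"
  shows "expectation (\<lambda>\<omega>. cos (Z \<omega>)) = exp (- q / 2)"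
proof -
  have [measurable]: "Z \<in> borel_measurable M" using assms(1) by (simp add: gaussian_rv_def)
  consider \<mu> where "AE \<omega> in M. Z \<omega> = \<mu>"
    | \<mu> \<sigma> where "0 < \<sigma>" "distributed M lborel Z (normal_density \<mu> \<sigma>)"
    using assms(1) unfolding gaussian_rv_def by blast
  then show ?thesis
  proof cases
    case 1
    have "expectation Z = expectation (\<lambda>_. \<mu>)"
      by (rule integral_cong_AE) (use 1 in auto)
    then have "\<mu> = 0" using assms(2) by (simp add: prob_space)
    have "expectation (\<lambda>\<omega>. (Z \<omega>)\<^sup>2) = expectation (\<lambda>_. 0)"
      by (rule integral_cong_AE) (use 1 \<open>\<mu> = 0\<close> in auto)
    moreover have "expectation (\<lambda>\<omega>. cos (Z \<omega>)) = expectation (\<lambda>_. 1)"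
      by (rule integral_cong_AE) (use 1 \<open>\<mu> = 0\<close> in auto)
    ultimately show ?thesis using assms(3) by (simp add: prob_space)
  next
    case 2
    have \<mu>: "\<mu> = 0"
      using normal_distributed_expectation[OF 2] assms(2) by simp
    have q: "\<sigma>\<^sup>2 = q"
      using normal_distributed_variance[OF 2] assms(2,3) by simp
    have "distributed M lborel (\<lambda>\<omega>. (Z \<omega> - 0) / \<sigma>) std_normal_density"
      using 2 normal_standard_normal_convert[OF 2(1), of Z 0] unfolding \<mu> by simp
    then have "(\<integral>x. std_normal_density x * cos (\<sigma> * x) \<partial>lborel)
        = expectation (\<lambda>\<omega>. cos (\<sigma> * ((Z \<omega> - 0) / \<sigma>)))"
      by (rule distributed_integral) auto
    moreover have "(\<integral>x. std_normal_density x * cos (\<sigma> * x) \<partial>lborel) = exp (- \<sigma>\<^sup>2 / 2)"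
      using integral_std_normal_cos[of \<sigma>] by (subst (asm) integral_density) auto
    ultimately show ?thesis using 2(1) by (simp add: q)
  qed
qed

text \<open>The Gaussian factor is the characteristic function of an independent standard normal variable,
  so that linear functionals of \<open>Y\<close> replace the square.\<close>
lemma (in prob_space) expectation_mult_exp_square:
  fixes h Y :: "'a \<Rightarrow> real"
  assumes [measurable]: "h \<in> borel_measurable M" "Y \<in> borel_measurable M"
    and h: "\<And>\<omega>. \<bar>h \<omega>\<bar> \<le> 1" and "0 \<le> b"
  shows "expectation (\<lambda>\<omega>. h \<omega> * exp (- (b * (Y \<omega>)\<^sup>2 / 2)))
    = (\<integral>x. expectation (\<lambda>\<omega>. h \<omega> * cos (sqrt b * x * Y \<omega>)) \<partial>std_normal_distribution)"
proof -
  interpret N: real_distribution std_normal_distribution by (rule real_dist_normal_dist)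
  interpret P: pair_prob_space M std_normal_distribution ..
  have "(\<integral>x. cos (sqrt b * x * Y \<omega>) \<partial>std_normal_distribution) = exp (- (b * (Y \<omega>)\<^sup>2 / 2))" for \<omega>
  proof -
    have "(\<integral>x. cos (sqrt b * x * Y \<omega>) \<partial>std_normal_distribution)
        = (\<integral>x. cos ((sqrt b * Y \<omega>) * x) \<partial>std_normal_distribution)"
      by (intro Bochner_Integration.integral_cong) (auto simp: mult_ac)
    then show ?thesis
      using \<open>0 \<le> b\<close> by (simp only: integral_std_normal_cos) (simp add: power_mult_distrib)
  qed
  then have "expectation (\<lambda>\<omega>. h \<omega> * exp (- (b * (Y \<omega>)\<^sup>2 / 2)))
      = expectation (\<lambda>\<omega>. \<integral>x. h \<omega> * cos (sqrt b * x * Y \<omega>) \<partial>std_normal_distribution)"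
    by simp
  also have "\<dots> = (\<integral>x. expectation (\<lambda>\<omega>. h \<omega> * cos (sqrt b * x * Y \<omega>)) \<partial>std_normal_distribution)"
  proof (rule P.Fubini_integral[symmetric])
    have "\<bar>h \<omega> * cos y\<bar> \<le> 1" for \<omega> y
      unfolding abs_mult using h[of \<omega>] by (intro mult_le_one) auto
    then show "integrable (M \<Otimes>\<^sub>M std_normal_distribution) (\<lambda>(\<omega>, x). h \<omega> * cos (sqrt b * x * Y \<omega>))"
      by (intro P.integrable_const_bound[where B=1]) auto
  qed
  finally show ?thesis .
qed

text \<open>The input is about cosines of linear combinations only, so it includes
  \<open>c\<^sup>2 = 1\<close>, where no joint density exists. Each square is linearised by an
  auxiliary standard normal variable, and these are integrated out one after the other.\<close>

lemma (in prob_space) gaussian_pair_laplace_squares: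
  fixes X Y :: "'a \<Rightarrow> real"
  assumes [measurable]: "X \<in> borel_measurable M" "Y \<in> borel_measurable M"
    and cos: "\<And>u v. expectation (\<lambda>\<omega>. cos (u * X \<omega> + v * Y \<omega>)) = exp (- (u\<^sup>2 + 2 * c * u * v + v\<^sup>2) / 2)"
    and "0 \<le> a" "0 \<le> b" "c\<^sup>2 \<le> 1"
  shows "expectation (\<lambda>\<omega>. exp (- (a * (X \<omega>)\<^sup>2 / 2)) * exp (- (b * (Y \<omega>)\<^sup>2 / 2)))
    = 1 / sqrt ((1 + a) * (1 + b) - c\<^sup>2 * a * b)"
proof -
  \<comment> \<open>The coefficient left on the auxiliary variable for \<open>X\<close> once the one
    for \<open>Y\<close> is integrated out. \<open>1 + g\<close> is a Schur complement, so
    \<open>(1 + g) * (1 + b)\<close> is the determinant.\<close>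
  define g where "g = a - c\<^sup>2 * a * b / (1 + b)"
  have b: "0 < 1 + b" using \<open>0 \<le> b\<close> by simp
  have "c\<^sup>2 * (a * b) \<le> 1 * (a * (1 + b))"
    using assms by (intro mult_mono) (auto simp: algebra_simps)
  then have g: "0 \<le> g"
    using b by (simp add: g_def field_simps)
  \<comment> \<open>Product-to-sum turns the product of cosines into cosines of linear functionals
    of the pair.\<close>
  have cos_cos: "expectation (\<lambda>\<omega>. cos (u * X \<omega>) * cos (v * Y \<omega>))
      = exp (- u\<^sup>2 / 2) * ((exp (- (v\<^sup>2 / 2) - c * u * v) + exp (- (v\<^sup>2 / 2) - - c * u * v)) / 2)" for u v
  proof -
    have "integrable M (\<lambda>\<omega>. cos (u * X \<omega> + w * Y \<omega>))" for w
      by (intro integrable_const_bound[where B=1]) auto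
    then have "expectation (\<lambda>\<omega>. cos (u * X \<omega> + v * Y \<omega>) + cos (u * X \<omega> + - v * Y \<omega>))
        = exp (- (u\<^sup>2 + 2 * c * u * v + v\<^sup>2) / 2) + exp (- (u\<^sup>2 + 2 * c * u * - v + (- v)\<^sup>2) / 2)"
      by (subst Bochner_Integration.integral_add) (auto simp only: cos)
    moreover have "(\<lambda>\<omega>. cos (u * X \<omega>) * cos (v * Y \<omega>))
        = (\<lambda>\<omega>. (cos (u * X \<omega> + v * Y \<omega>) + cos (u * X \<omega> + - v * Y \<omega>)) / 2)"
      by (simp add: cos_add cos_diff fun_eq_iff)
    moreover have "exp (- (u\<^sup>2 + 2 * c * u * v + v\<^sup>2) / 2) = exp (- u\<^sup>2 / 2) * exp (- (v\<^sup>2 / 2) - c * u * v)"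
      "exp (- (u\<^sup>2 + 2 * c * u * - v + (- v)\<^sup>2) / 2) = exp (- u\<^sup>2 / 2) * exp (- (v\<^sup>2 / 2) - - c * u * v)"
      unfolding exp_add[symmetric] by (simp_all add: field_simps)
    ultimately show ?thesis by (simp add: algebra_simps)
  qed
  have inner: "expectation (\<lambda>\<omega>. cos (u * X \<omega>) * exp (- (b * (Y \<omega>)\<^sup>2 / 2)))
      = exp (- u\<^sup>2 / 2) * exp (c\<^sup>2 * u\<^sup>2 * b / (2 * (1 + b))) / sqrt (1 + b)" for u
  proof -
    have "expectation (\<lambda>\<omega>. cos (u * X \<omega>) * exp (- (b * (Y \<omega>)\<^sup>2 / 2)))
        = (\<integral>x. expectation (\<lambda>\<omega>. cos (u * X \<omega>) * cos (sqrt b * x * Y \<omega>)) \<partial>std_normal_distribution)"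
      using \<open>0 \<le> b\<close> by (intro expectation_mult_exp_square) auto
    also have "\<dots> = (\<integral>x. exp (- u\<^sup>2 / 2) * ((exp (- (b * x\<^sup>2 / 2) - (c * u * sqrt b) * x)
        + exp (- (b * x\<^sup>2 / 2) - (- c * u * sqrt b) * x)) / 2) \<partial>std_normal_distribution)"
      unfolding cos_cos using \<open>0 \<le> b\<close> by (simp add: power_mult_distrib mult_ac)
    also have "\<dots> = exp (- u\<^sup>2 / 2) * ((exp ((c * u * sqrt b)\<^sup>2 / (2 * (1 + b))) / sqrt (1 + b)
        + exp ((- c * u * sqrt b)\<^sup>2 / (2 * (1 + b))) / sqrt (1 + b)) / 2)"
      by (rule has_bochner_integral_integral_eq)
        (intro has_bochner_integral_mult_right has_bochner_integral_divide_zero has_bochner_integral_add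
          has_bochner_integral_std_normal_exp_quadratic \<open>0 \<le> b\<close>)
    also have "\<dots> = exp (- u\<^sup>2 / 2) * exp (c\<^sup>2 * u\<^sup>2 * b / (2 * (1 + b))) / sqrt (1 + b)"
      using \<open>0 \<le> b\<close> by (simp add: power_mult_distrib)
    finally show ?thesis .
  qed
  have "expectation (\<lambda>\<omega>. exp (- (a * (X \<omega>)\<^sup>2 / 2)) * exp (- (b * (Y \<omega>)\<^sup>2 / 2)))
      = expectation (\<lambda>\<omega>. exp (- (b * (Y \<omega>)\<^sup>2 / 2)) * exp (- (a * (X \<omega>)\<^sup>2 / 2)))"
    by (simp add: mult.commute)
  also have "\<dots> = (\<integral>x. expectation (\<lambda>\<omega>. exp (- (b * (Y \<omega>)\<^sup>2 / 2)) * cos (sqrt a * x * X \<omega>))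
      \<partial>std_normal_distribution)"
    using \<open>0 \<le> a\<close> \<open>0 \<le> b\<close> by (intro expectation_mult_exp_square) auto
  also have "\<dots> = (\<integral>x. exp (- (g * x\<^sup>2 / 2) - 0 * x) / sqrt (1 + b) \<partial>std_normal_distribution)"
  proof (intro Bochner_Integration.integral_cong refl)
    fix x
    have "- (sqrt a * x)\<^sup>2 / 2 + c\<^sup>2 * (sqrt a * x)\<^sup>2 * b / (2 * (1 + b)) = - (g * x\<^sup>2 / 2) - 0 * x"
      using \<open>0 \<le> a\<close> b by (simp add: g_def power_mult_distrib field_simps)
    then show "expectation (\<lambda>\<omega>. exp (- (b * (Y \<omega>)\<^sup>2 / 2)) * cos (sqrt a * x * X \<omega>))
        = exp (- (g * x\<^sup>2 / 2) - 0 * x) / sqrt (1 + b)"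
      using inner[of "sqrt a * x"] by (simp add: exp_add[symmetric] mult.commute)
  qed
  also have "\<dots> = exp (0\<^sup>2 / (2 * (1 + g))) / sqrt (1 + g) / sqrt (1 + b)"
    by (intro has_bochner_integral_integral_eq has_bochner_integral_divide_zero
        has_bochner_integral_std_normal_exp_quadratic g)
  also have "\<dots> = 1 / sqrt ((1 + g) * (1 + b))"
    by (simp add: real_sqrt_mult)
  also have "(1 + g) * (1 + b) = (1 + a) * (1 + b) - c\<^sup>2 * a * b"
    using b by (simp add: g_def field_simps)
  finally show ?thesis .
qed

section \<open>Bivariate renewal processes with exponential marginals\<close>

text \<open>Index pairs are listed by their smaller entry and the surplus of the larger; the surplus
  starts at 0 on one side and at 1 on the other, so the diagonal is counted once.\<close>

lemma suminf_suminf_split_diagonal: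
  fixes f :: "nat \<Rightarrow> nat \<Rightarrow> ennreal"
  shows "(\<Sum>m. \<Sum>n. f m n) = (\<Sum>n. \<Sum>d. f n (n + d)) + (\<Sum>n. \<Sum>d. f (n + Suc d) n)"
proof -
  have split: "suminf g = (\<Sum>i. g (k + i)) + sum g {..<k}" for g :: "nat \<Rightarrow> ennreal" and k
    using suminf_offset[of g k] by (simp add: add.commute)
  have restrict: "sum g {..<k} = (\<Sum>i. if i < k then g i else 0)" for g :: "nat \<Rightarrow> ennreal" and k
    by (subst suminf_finite[of "{..<k}"]) auto
  have swap: "(\<Sum>m. \<Sum>n. g m n) = (\<Sum>n. \<Sum>m. g m n)" for g :: "nat \<Rightarrow> nat \<Rightarrow> ennreal"
    using nn_integral_suminf[of "\<lambda>n m. g m n" "count_space UNIV"] by (simp add: nn_integral_count_space_nat)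
  have "(\<Sum>m. \<Sum>n. f m n) = (\<Sum>m. (\<Sum>d. f m (m + d)) + (\<Sum>n. if n < m then f m n else 0))"
    using split[of "f m" m for m] by (simp only: restrict)
  also have "\<dots> = (\<Sum>m. \<Sum>d. f m (m + d)) + (\<Sum>m. \<Sum>n. if n < m then f m n else 0)"
    by (intro suminf_add[symmetric]) auto
  also have "(\<Sum>m. \<Sum>n. if n < m then f m n else 0) = (\<Sum>n. \<Sum>m. if n < m then f m n else 0)"
    by (rule swap)
  also have "\<dots> = (\<Sum>n. \<Sum>d. f (n + Suc d) n)"
  proof (rule suminf_cong)
    fix n
    show "(\<Sum>m. if n < m then f m n else 0) = (\<Sum>d. f (n + Suc d) n)"
      by (subst split[of _ "Suc n"]) simp
  qed
  finally show ?thesis .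
qed

lemma suminf_ennreal_geometric:
  fixes c x :: real
  assumes "0 \<le> c" "0 \<le> x" "x < 1"
  shows "(\<Sum>n. ennreal (c * x ^ n)) = ennreal (c * (1 / (1 - x)))"
  using assms by (intro suminf_ennreal_eq sums_mult geometric_sums) auto

text \<open>The transform of the Moran-Downton bivariate exponential law with unit means and
  correlation \<open>r\<close>.\<close>

definition bivariate_exp_laplace :: "real \<Rightarrow> real \<Rightarrow> real \<Rightarrow> real" where
  "bivariate_exp_laplace r a b = 1 / ((1 + a) * (1 + b) - r * a * b)"

text \<open>Keeps the transform nonnegative, and strictly below 1 at positive arguments, as the
  geometric series requires.\<close>

lemma bivariate_exp_laplace_denominator:
  fixes r a b :: real
  assumes "r \<le> 1" "0 \<le> a" "0 \<le> b"
  shows "1 + a + b \<le> (1 + a) * (1 + b) - r * a * b"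
proof -
  have "r * (a * b) \<le> 1 * (a * b)" using assms by (intro mult_right_mono) auto
  then show ?thesis by (simp add: algebra_simps)
qed

lemma bivariate_exp_laplace_nonneg:
  assumes "r \<le> 1" "0 \<le> a" "0 \<le> b" shows "0 \<le> bivariate_exp_laplace r a b"
  using bivariate_exp_laplace_denominator[OF assms] assms by (simp add: bivariate_exp_laplace_def)

lemma bivariate_exp_laplace_less_1:
  assumes "r \<le> 1" "0 < a" "0 < b" shows "bivariate_exp_laplace r a b < 1"
  using bivariate_exp_laplace_denominator[of r a b] assms by (simp add: bivariate_exp_laplace_def)

lemma bivariate_exp_laplace_commute: "bivariate_exp_laplace r a b = bivariate_exp_laplace r b a"
  by (simp add: bivariate_exp_laplace_def mult_ac)

lemma bivariate_exp_laplace_0: "bivariate_exp_laplace r 0 b = 1 / (1 + b)"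
  by (simp add: bivariate_exp_laplace_def)

definition renewal_laplace :: "real \<Rightarrow> real \<Rightarrow> real \<Rightarrow> real" where
  "renewal_laplace r a b = 1 / (a * b) + r / (a + b + (1 - r) * a * b)"

text \<open>Index \<open>m\<close> stands for \<open>m + 1\<close> increments: the empty sum is left
  out and every natural number is a valid index.\<close>

definition partial_sum :: "(nat \<Rightarrow> 'a \<Rightarrow> real) \<Rightarrow> nat \<Rightarrow> 'a \<Rightarrow> real" where
  "partial_sum X m \<omega> = (\<Sum>i=1..Suc m. X i \<omega>)"

text \<open>As a cardinality the count is a sum of indicators, so its mean is a sum of
  probabilities. On an infinite set \<open>card\<close> is 0; that event is null by
  \<open>AE_finite_partial_sum_le\<close>.\<close>

definition partial_count :: "(nat \<Rightarrow> 'a \<Rightarrow> real) \<Rightarrow> real \<Rightarrow> 'a \<Rightarrow> nat" where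
  "partial_count X t \<omega> = card {m. partial_sum X m \<omega> \<le> t}"

text \<open>Increments at two sites, scaled to unit mean; the two coordinates of one step may be
  dependent, different steps are independent. Zero arguments in \<open>laplace\<close> supply the
  marginal laws.\<close>

locale bivariate_renewal = prob_space M for M :: "'a measure" +
  fixes X Y :: "nat \<Rightarrow> 'a \<Rightarrow> real" and r :: real
  assumes indep: "indep_vars (\<lambda>_. borel \<Otimes>\<^sub>M borel) (\<lambda>i \<omega>. (X i \<omega>, Y i \<omega>)) {1..}"
    and nonneg: "\<And>i. 1 \<le> i \<Longrightarrow> AE \<omega> in M. 0 \<le> X i \<omega> \<and> 0 \<le> Y i \<omega>"
    and laplace: "\<And>i a b. 1 \<le> i \<Longrightarrow> 0 \<le> a \<Longrightarrow> 0 \<le> b \<Longrightarrow>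
      (\<integral>\<^sup>+\<omega>. ennreal (exp (- (a * X i \<omega> + b * Y i \<omega>))) \<partial>M) = ennreal (bivariate_exp_laplace r a b)"
    and r: "0 \<le> r" "r \<le> 1"
begin

lemma measurable_increments:
  assumes "1 \<le> i" shows "X i \<in> borel_measurable M" "Y i \<in> borel_measurable M"
proof -
  have "(\<lambda>\<omega>. (X i \<omega>, Y i \<omega>)) \<in> M \<rightarrow>\<^sub>M borel \<Otimes>\<^sub>M borel"
    using indep assms unfolding indep_vars_def2 by auto
  from measurable_compose[OF this measurable_fst] measurable_compose[OF this measurable_snd]
  show "X i \<in> borel_measurable M" "Y i \<in> borel_measurable M" by simp_all
qed

lemma measurable_partial_sum [measurable]:
  "partial_sum X m \<in> borel_measurable M" "partial_sum Y m \<in> borel_measurable M"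
  unfolding partial_sum_def[abs_def] by (intro borel_measurable_sum measurable_increments; simp)+

lemma partial_sum_nonneg: "AE \<omega> in M. \<forall>m. 0 \<le> partial_sum X m \<omega> \<and> 0 \<le> partial_sum Y m \<omega>"
proof -
  have "AE \<omega> in M. \<forall>i\<in>{1..}. 0 \<le> X i \<omega> \<and> 0 \<le> Y i \<omega>"
    using nonneg by (subst AE_ball_countable) auto
  then show ?thesis
    unfolding partial_sum_def by eventually_elim (auto simp del: sum.cl_ivl_Suc intro!: sum_nonneg)
qed

text \<open>The weights depend on the step so that partial sums of different lengths can be treated
  together: weight 0 drops an increment.\<close>

lemma laplace_weighted:
  assumes "\<And>i. 0 \<le> a i" "\<And>i. 0 \<le> b i"
  shows "(\<integral>\<^sup>+\<omega>. ennreal (exp (- (\<Sum>i=1..n. a i * X i \<omega> + b i * Y i \<omega>))) \<partial>M)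
    = ennreal (\<Prod>i=1..n. bivariate_exp_laplace r (a i) (b i))"
proof -
  have "indep_vars (\<lambda>_. borel) (\<lambda>i \<omega>. (\<lambda>(x, y). ennreal (exp (- (a i * x + b i * y)))) (X i \<omega>, Y i \<omega>)) {1..n}"
    by (rule indep_vars_compose2[OF indep_vars_subset[OF indep]]) auto
  then have "(\<integral>\<^sup>+\<omega>. (\<Prod>i=1..n. ennreal (exp (- (a i * X i \<omega> + b i * Y i \<omega>)))) \<partial>M)
      = (\<Prod>i=1..n. \<integral>\<^sup>+\<omega>. ennreal (exp (- (a i * X i \<omega> + b i * Y i \<omega>))) \<partial>M)"
    by (subst indep_vars_nn_integral[symmetric]) auto
  also have "\<dots> = (\<Prod>i=1..n. ennreal (bivariate_exp_laplace r (a i) (b i)))"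
    using assms by (intro prod.cong laplace) auto
  also have "\<dots> = ennreal (\<Prod>i=1..n. bivariate_exp_laplace r (a i) (b i))"
    using assms r by (intro prod_ennreal bivariate_exp_laplace_nonneg)
  finally show ?thesis
    by (simp only: prod_ennreal exp_ge_zero exp_sum[OF finite_atLeastAtMost, symmetric] sum_negf)
qed

lemma laplace_partial_sums:
  assumes "0 \<le> a" "0 \<le> b"
  shows "(\<integral>\<^sup>+\<omega>. ennreal (exp (- (a * partial_sum X m \<omega> + b * partial_sum Y (m + d) \<omega>))) \<partial>M)
    = ennreal (bivariate_exp_laplace r a b ^ Suc m * (1 / (1 + b)) ^ d)"
proof -
  \<comment> \<open>Switches the first coordinate off after step \<open>Suc m\<close>; each of the
    \<open>d\<close> surplus steps then contributes the marginal transform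
    \<open>1 / (1 + b)\<close>.\<close>
  define a' where "a' i = (if i \<le> Suc m then a else 0)" for i
  have "(\<Sum>i=1..Suc (m + d). a' i * X i \<omega> + b * Y i \<omega>)
      = a * partial_sum X m \<omega> + b * partial_sum Y (m + d) \<omega>" for \<omega>
  proof (induction d)
    case 0
    have "(\<Sum>i=1..Suc m. a' i * X i \<omega> + b * Y i \<omega>) = (\<Sum>i=1..Suc m. a * X i \<omega> + b * Y i \<omega>)"
      by (intro sum.cong) (auto simp: a'_def)
    then show ?case by (simp only: partial_sum_def sum.distrib sum_distrib_left add_0_right)
  next
    case (Suc d)
    have "a' (Suc (Suc (m + d))) = 0" by (simp add: a'_def)
    moreover have "partial_sum Y (Suc (m + d)) \<omega> = partial_sum Y (m + d) \<omega> + Y (Suc (Suc (m + d))) \<omega>"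
      by (simp add: partial_sum_def)
    ultimately show ?case using Suc by (simp add: algebra_simps)
  qed
  moreover have "(\<Prod>i=1..Suc (m + d). bivariate_exp_laplace r (a' i) b)
      = bivariate_exp_laplace r a b ^ Suc m * (1 / (1 + b)) ^ d"
  proof (induction d)
    case 0
    have "(\<Prod>i=1..Suc m. bivariate_exp_laplace r (a' i) b) = (\<Prod>i=1..Suc m. bivariate_exp_laplace r a b)"
      by (intro prod.cong) (auto simp: a'_def)
    then show ?case by simp
  next
    case (Suc d)
    have "a' (Suc (Suc (m + d))) = 0" by (simp add: a'_def)
    with Suc show ?case by (simp add: bivariate_exp_laplace_0)
  qed
  moreover have "0 \<le> a' i" for i using assms by (simp add: a'_def)
  ultimately show ?thesis
    using laplace_weighted[of a' "\<lambda>_. b" "Suc (m + d)"] assms by simp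
qed

text \<open>Lets results for a longer second sum serve for a longer first sum, and results about
  \<open>X\<close> serve for \<open>Y\<close>.\<close>

lemma swap: "bivariate_renewal M Y X r"
proof
  have "indep_vars (\<lambda>_. borel \<Otimes>\<^sub>M borel) (\<lambda>i \<omega>. prod.swap (X i \<omega>, Y i \<omega>)) {1..}"
    by (rule indep_vars_compose2[OF indep]) (simp add: prod.swap_def)
  then show "indep_vars (\<lambda>_. borel \<Otimes>\<^sub>M borel) (\<lambda>i \<omega>. (Y i \<omega>, X i \<omega>)) {1..}"
    by simp
next
  fix i :: nat and a b :: real assume "1 \<le> i" "0 \<le> a" "0 \<le> b"
  then show "(\<integral>\<^sup>+\<omega>. ennreal (exp (- (a * Y i \<omega> + b * X i \<omega>))) \<partial>M) = ennreal (bivariate_exp_laplace r a b)"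
    using laplace[of i b a] by (simp add: add.commute bivariate_exp_laplace_commute)
qed (use nonneg r in \<open>auto simp: conj_commute\<close>)

section \<open>The renewal measure of the pair and its mass on squares\<close>

abbreviation "joint_space \<equiv> (count_space UNIV :: (nat \<times> nat) measure) \<Otimes>\<^sub>M M"

text \<open>Counting measure on index pairs turns the double sum of laws into one measure, whose
  transform is the double sum of transforms. After sorting by the smaller index, the sum over the
  surplus and the sum over the smaller index are both geometric.\<close>

lemma joint_laplace_partial_sums:
  "has_joint_laplace joint_space (\<lambda>(p, \<omega>). partial_sum X (fst p) \<omega>) (\<lambda>(p, \<omega>). partial_sum Y (snd p) \<omega>)
    (renewal_laplace r)"
  unfolding has_joint_laplace_def
proof (intro conjI allI impI)
  interpret P: pair_sigma_finite "count_space UNIV :: (nat \<times> nat) measure" M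
    by (intro pair_sigma_finite.intro sigma_finite_measure_count_space sigma_finite_measure_axioms)
  show meas [measurable]: "(\<lambda>(p, \<omega>). partial_sum X (fst p) \<omega>) \<in> borel_measurable joint_space"
    "(\<lambda>(p, \<omega>). partial_sum Y (snd p) \<omega>) \<in> borel_measurable joint_space"
    by (rule measurable_pair_measure_countable1; simp)+
  have "AE z in joint_space. 0 \<le> (case z of (p, \<omega>) \<Rightarrow> partial_sum X (fst p) \<omega>)
      \<and> 0 \<le> (case z of (p, \<omega>) \<Rightarrow> partial_sum Y (snd p) \<omega>)"
    using partial_sum_nonneg by (intro P.AE_pair_measure) (measurable, auto elim!: eventually_mono)
  then show "AE z in joint_space. 0 \<le> (case z of (p, \<omega>) \<Rightarrow> partial_sum X (fst p) \<omega>)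
      \<and> 0 \<le> (case z of (p, \<omega>) \<Rightarrow> partial_sum Y (snd p) \<omega>)" .
  fix a b :: real assume ab: "0 < a" "0 < b"
  have "0 < a + b + (1 - r) * a * b"
    using ab r by (intro add_pos_nonneg) auto
  then show "0 \<le> renewal_laplace r a b"
    using ab r by (simp add: renewal_laplace_def)
  interpret swapped: bivariate_renewal M Y X r by (rule swap)
  define \<phi> where "\<phi> = bivariate_exp_laplace r a b"
  have \<phi>: "0 \<le> \<phi>" "\<phi> < 1"
    using bivariate_exp_laplace_nonneg[of r a b] bivariate_exp_laplace_less_1[of r a b] ab r
    by (auto simp: \<phi>_def)
  define I where "I m n = (\<integral>\<^sup>+\<omega>. ennreal (exp (- (a * partial_sum X m \<omega> + b * partial_sum Y n \<omega>))) \<partial>M)" for m n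
  have I1: "I n (n + d) = ennreal ((\<phi> * \<phi> ^ n) * (1 / (1 + b)) ^ d)" for n d
    using laplace_partial_sums[of a b n d] ab by (simp add: I_def \<phi>_def)
  \<comment> \<open>Comes from the swapped process. The surplus starts at 1, hence the extra factor
    \<open>1 / (1 + a)\<close>, which makes \<open>a\<close> and \<open>b\<close> enter the two
    totals differently.\<close>
  have I2: "I (n + Suc d) n = ennreal ((\<phi> * \<phi> ^ n * (1 / (1 + a))) * (1 / (1 + a)) ^ d)" for n d
    using swapped.laplace_partial_sums[of b a n "Suc d"] ab bivariate_exp_laplace_commute[of r b a]
    by (simp add: I_def \<phi>_def add.commute)
  have geo: "1 / (1 - 1 / (1 + c)) = (1 + c) / c" if "0 < c" for c :: real
    using that by (simp add: field_simps)
  have S1: "(\<Sum>n. \<Sum>d. I n (n + d)) = ennreal (\<phi> * ((1 + b) / b) * (1 / (1 - \<phi>)))"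
  proof -
    have "(\<Sum>d. I n (n + d)) = ennreal ((\<phi> * ((1 + b) / b)) * \<phi> ^ n)" for n
      unfolding I1 using \<phi> ab
      by (subst suminf_ennreal_geometric) (auto simp: geo mult_ac)
    then show ?thesis using \<phi> ab by (simp only:) (subst suminf_ennreal_geometric, auto)
  qed
  have S2: "(\<Sum>n. \<Sum>d. I (n + Suc d) n) = ennreal (\<phi> * (1 / a) * (1 / (1 - \<phi>)))"
  proof -
    have "(\<Sum>d. I (n + Suc d) n) = ennreal ((\<phi> * (1 / a)) * \<phi> ^ n)" for n
      unfolding I2 using \<phi> ab
      by (subst suminf_ennreal_geometric) (auto simp: geo mult_ac)
    then show ?thesis using \<phi> ab by (simp only:) (subst suminf_ennreal_geometric, auto)
  qed
  have "(\<integral>\<^sup>+z. ennreal (exp (- (a * (case z of (p, \<omega>) \<Rightarrow> partial_sum X (fst p) \<omega>)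
      + b * (case z of (p, \<omega>) \<Rightarrow> partial_sum Y (snd p) \<omega>)))) \<partial>joint_space)
      = (\<integral>\<^sup>+p. I (fst p) (snd p) \<partial>count_space UNIV)"
    by (subst nn_integral_fst[symmetric]) (auto simp: I_def)
  also have "\<dots> = (\<Sum>m. \<Sum>n. I m n)"
    by (subst nn_integral_fst_count_space[symmetric]) (simp add: nn_integral_count_space_nat)
  also have "\<dots> = ennreal (\<phi> * ((1 + b) / b) * (1 / (1 - \<phi>))) + ennreal (\<phi> * (1 / a) * (1 / (1 - \<phi>)))"
    by (subst suminf_suminf_split_diagonal) (simp only: S1 S2)
  also have "\<dots> = ennreal (\<phi> / (1 - \<phi>) * ((1 + b) / b + 1 / a))"
  proof -
    have "\<phi> * c * (1 / (1 - \<phi>)) + \<phi> * d * (1 / (1 - \<phi>)) = \<phi> / (1 - \<phi>) * (c + d)" for c d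
      by (simp add: distrib_left)
    moreover have "0 \<le> \<phi> * ((1 + b) / b) * (1 / (1 - \<phi>))" "0 \<le> \<phi> * (1 / a) * (1 / (1 - \<phi>))"
      using \<phi> ab by auto
    ultimately show ?thesis by (simp only: ennreal_plus[symmetric])
  qed
  also have "\<phi> / (1 - \<phi>) * ((1 + b) / b + 1 / a) = renewal_laplace r a b"
  proof -
    \<comment> \<open>\<open>D\<close> is \<open>1 / \<phi> - 1\<close>; writing
      \<open>a + b + a * b\<close> as \<open>D + r * (a * b)\<close> separates the product term from
      the remainder.\<close>
    define D where "D = a + b + (1 - r) * a * b"
    have D: "0 < D" unfolding D_def by fact
    have \<phi>_eq: "\<phi> = 1 / (1 + D)"
      by (simp add: \<phi>_def bivariate_exp_laplace_def D_def algebra_simps)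
    have "\<phi> / (1 - \<phi>) = 1 / D"
      unfolding \<phi>_eq using D by (simp add: divide_simps)
    moreover have "(1 + b) / b + 1 / a = (D + r * (a * b)) / (a * b)"
      using ab by (simp add: D_def field_simps)
    ultimately have "\<phi> / (1 - \<phi>) * ((1 + b) / b + 1 / a) = 1 / D * ((D + r * (a * b)) / (a * b))"
      by (simp only:)
    also have "\<dots> = renewal_laplace r a b"
      unfolding renewal_laplace_def D_def[symmetric] using D ab by (simp add: field_simps)
    finally show ?thesis .
  qed
  finally show "(\<integral>\<^sup>+z. ennreal (exp (- (a * (case z of (p, \<omega>) \<Rightarrow> partial_sum X (fst p) \<omega>)
      + b * (case z of (p, \<omega>) \<Rightarrow> partial_sum Y (snd p) \<omega>)))) \<partial>joint_space)
      = ennreal (renewal_laplace r a b)" .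
qed

text \<open>The renewal measure of one process has the transform of Lebesgue measure on the half
  line, again by a geometric series. Doubling the coordinate makes the two-dimensional comparison
  applicable.\<close>

lemma single_laplace_partial_sums:
  "has_joint_laplace (count_space UNIV \<Otimes>\<^sub>M M) (\<lambda>(m, \<omega>). partial_sum X m \<omega>) (\<lambda>(m, \<omega>). partial_sum X m \<omega>)
    (\<lambda>a b. 1 / (a + b))"
  unfolding has_joint_laplace_def
proof (intro conjI allI impI)
  interpret P: pair_sigma_finite "count_space UNIV :: nat measure" M
    by (intro pair_sigma_finite.intro sigma_finite_measure_count_space sigma_finite_measure_axioms)
  show meas [measurable]: "(\<lambda>(m, \<omega>). partial_sum X m \<omega>) \<in> borel_measurable (count_space UNIV \<Otimes>\<^sub>M M)"
    by (rule measurable_pair_measure_countable1; simp)+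
  then show "(\<lambda>(m, \<omega>). partial_sum X m \<omega>) \<in> borel_measurable (count_space UNIV \<Otimes>\<^sub>M M)" .
  show "AE z in count_space UNIV \<Otimes>\<^sub>M M. 0 \<le> (case z of (m, \<omega>) \<Rightarrow> partial_sum X m \<omega>)
      \<and> 0 \<le> (case z of (m, \<omega>) \<Rightarrow> partial_sum X m \<omega>)"
    using partial_sum_nonneg by (intro P.AE_pair_measure) (measurable, auto elim!: eventually_mono)
  fix a b :: real assume ab: "0 < a" "0 < b"
  define c where "c = a + b"
  have c: "0 < c" using ab by (simp add: c_def)
  have "bivariate_exp_laplace r c 0 = 1 / (1 + c)"
    by (simp add: bivariate_exp_laplace_def)
  then have single: "(\<integral>\<^sup>+\<omega>. ennreal (exp (- (c * partial_sum X m \<omega>))) \<partial>M)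
      = ennreal (1 / (1 + c) * (1 / (1 + c)) ^ m)" for m
    using laplace_partial_sums[of c 0 m 0] c by simp
  have "(\<integral>\<^sup>+z. ennreal (exp (- (a * (case z of (m, \<omega>) \<Rightarrow> partial_sum X m \<omega>)
      + b * (case z of (m, \<omega>) \<Rightarrow> partial_sum X m \<omega>)))) \<partial>(count_space UNIV \<Otimes>\<^sub>M M))
      = (\<integral>\<^sup>+z. ennreal (exp (- (c * (case z of (m, \<omega>) \<Rightarrow> partial_sum X m \<omega>))))
          \<partial>(count_space UNIV \<Otimes>\<^sub>M M))"
    by (simp only: c_def distrib_right)
  also have "\<dots> = (\<integral>\<^sup>+m. (\<integral>\<^sup>+\<omega>. ennreal (exp (- (c * partial_sum X m \<omega>))) \<partial>M) \<partial>count_space UNIV)"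
    by (subst nn_integral_fst[symmetric]) simp_all
  also have "\<dots> = (\<Sum>m. ennreal (1 / (1 + c) * (1 / (1 + c)) ^ m))"
    by (simp only: single nn_integral_count_space_nat)
  also have "\<dots> = ennreal (1 / (1 + c) * (1 / (1 - 1 / (1 + c))))"
    using c by (intro suminf_ennreal_geometric) auto
  also have "1 / (1 + c) * (1 / (1 - 1 / (1 + c))) = 1 / (a + b)"
    unfolding c_def[symmetric] using c by (simp add: divide_simps)
  finally show "(\<integral>\<^sup>+z. ennreal (exp (- (a * (case z of (m, \<omega>) \<Rightarrow> partial_sum X m \<omega>)
      + b * (case z of (m, \<omega>) \<Rightarrow> partial_sum X m \<omega>)))) \<partial>(count_space UNIV \<Otimes>\<^sub>M M))
      = ennreal (1 / (a + b))" .
qed auto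

text \<open>The expected number of partial sums up to \<open>t\<close> is the renewal mass
  \<open>t\<close>; a variable with finite mean is finite almost surely.\<close>

lemma AE_finite_partial_sum_le:
  assumes "0 \<le> t"
  shows "AE \<omega> in M. finite {m. partial_sum X m \<omega> \<le> t}"
    and "(\<integral>\<^sup>+\<omega>. ennreal (real (partial_count X t \<omega>)) \<partial>M) = ennreal t"
proof -
  interpret P: pair_sigma_finite "count_space UNIV :: nat measure" M
    by (intro pair_sigma_finite.intro sigma_finite_measure_count_space sigma_finite_measure_axioms)
  let ?N = "count_space UNIV \<Otimes>\<^sub>M M"
  define Q where "Q = {z \<in> space ?N. (case z of (m, \<omega>) \<Rightarrow> partial_sum X m \<omega>) \<le> t
      \<and> (case z of (m, \<omega>) \<Rightarrow> partial_sum X m \<omega>) \<le> t}"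
  have [measurable]: "(\<lambda>(m, \<omega>). partial_sum X m \<omega>) \<in> borel_measurable ?N"
    by (rule measurable_pair_measure_countable1) simp_all
  have Q [measurable]: "Q \<in> sets ?N"
    unfolding Q_def by measurable
  have "measure ?N Q = t"
    unfolding Q_def
    by (subst has_joint_laplace_square_eq[OF single_laplace_partial_sums half_line_transform assms])
      (rule half_line_square[OF assms])
  moreover have "emeasure ?N Q < \<infinity>"
    unfolding Q_def by (rule has_joint_laplace_square_finite[OF single_laplace_partial_sums])
  ultimately have Q_emeasure: "emeasure ?N Q = ennreal t"
    by (simp add: emeasure_eq_ennreal_measure less_top)
  \<comment> \<open>Counting measure is infinite where \<open>card\<close> would be 0, so a finite
    mean of \<open>C\<close> does exclude infinite index sets.\<close>
  define C where "C \<omega> = emeasure (count_space UNIV) ((\<lambda>m. (m, \<omega>)) -` Q)" for \<omega>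
  have [measurable]: "C \<in> borel_measurable M"
    unfolding C_def by (rule P.measurable_emeasure_Pair2[OF Q])
  have C_int: "(\<integral>\<^sup>+\<omega>. C \<omega> \<partial>M) = ennreal t"
    unfolding C_def using P.emeasure_pair_measure_alt2[OF Q] Q_emeasure by simp
  have C_eq: "C \<omega> = (if finite {m. partial_sum X m \<omega> \<le> t} then of_nat (partial_count X t \<omega>) else \<infinity>)"
    if "\<omega> \<in> space M" for \<omega>
  proof -
    have "(\<lambda>m. (m, \<omega>)) -` Q = {m. partial_sum X m \<omega> \<le> t}"
      using that by (auto simp: Q_def space_pair_measure)
    then show ?thesis by (simp add: C_def emeasure_count_space partial_count_def)
  qed
  have "AE \<omega> in M. C \<omega> \<noteq> \<infinity>"
    by (rule nn_integral_noteq_infinite) (simp_all add: C_int)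
  with AE_space show fin: "AE \<omega> in M. finite {m. partial_sum X m \<omega> \<le> t}"
    by eventually_elim (auto simp: C_eq split: if_splits)
  have "(\<integral>\<^sup>+\<omega>. ennreal (real (partial_count X t \<omega>)) \<partial>M) = (\<integral>\<^sup>+\<omega>. C \<omega> \<partial>M)"
    by (rule nn_integral_cong_AE, use fin AE_space in eventually_elim)
      (simp add: C_eq ennreal_of_nat_eq_real_of_nat)
  with C_int show "(\<integral>\<^sup>+\<omega>. ennreal (real (partial_count X t \<omega>)) \<partial>M) = ennreal t" by simp
qed

definition joint_mass :: "real \<Rightarrow> real" where
  "joint_mass t = measure joint_space {z \<in> space joint_space.
     (case z of (p, \<omega>) \<Rightarrow> partial_sum X (fst p) \<omega>) \<le> t \<and> (case z of (p, \<omega>) \<Rightarrow> partial_sum Y (snd p) \<omega>) \<le> t}"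

text \<open>The section of the square at an outcome is a rectangle of indices, whose cardinality is
  the product of the two counts.\<close>

lemma nn_integral_partial_count_mult:
  assumes "0 \<le> t"
  shows "(\<integral>\<^sup>+\<omega>. ennreal (real (partial_count X t \<omega>) * real (partial_count Y t \<omega>)) \<partial>M)
    = ennreal (joint_mass t)"
proof -
  interpret swapped: bivariate_renewal M Y X r by (rule swap)
  interpret P: pair_sigma_finite "count_space UNIV :: (nat \<times> nat) measure" M
    by (intro pair_sigma_finite.intro sigma_finite_measure_count_space sigma_finite_measure_axioms)
  define Q where "Q = {z \<in> space joint_space.
     (case z of (p, \<omega>) \<Rightarrow> partial_sum X (fst p) \<omega>) \<le> t \<and> (case z of (p, \<omega>) \<Rightarrow> partial_sum Y (snd p) \<omega>) \<le> t}"
  have [measurable]: "(\<lambda>(p, \<omega>). partial_sum X (fst p) \<omega>) \<in> borel_measurable joint_space"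
    "(\<lambda>(p, \<omega>). partial_sum Y (snd p) \<omega>) \<in> borel_measurable joint_space"
    by (rule measurable_pair_measure_countable1; simp)+
  have Q [measurable]: "Q \<in> sets joint_space"
    unfolding Q_def by measurable
  have "emeasure joint_space Q < \<infinity>"
    unfolding Q_def by (rule has_joint_laplace_square_finite[OF joint_laplace_partial_sums])
  then have "emeasure joint_space Q = ennreal (joint_mass t)"
    by (simp add: emeasure_eq_ennreal_measure less_top joint_mass_def Q_def)
  moreover have "emeasure joint_space Q = (\<integral>\<^sup>+\<omega>. emeasure (count_space UNIV) ((\<lambda>p. (p, \<omega>)) -` Q) \<partial>M)"
    by (rule P.emeasure_pair_measure_alt2[OF Q])
  moreover have "\<dots> = (\<integral>\<^sup>+\<omega>. ennreal (real (partial_count X t \<omega>) * real (partial_count Y t \<omega>)) \<partial>M)"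
  proof (rule nn_integral_cong_AE, use AE_finite_partial_sum_le(1)[OF assms]
      swapped.AE_finite_partial_sum_le(1)[OF assms] AE_space in eventually_elim)
    fix \<omega>
    assume fin: "finite {m. partial_sum X m \<omega> \<le> t}" "finite {m. partial_sum Y m \<omega> \<le> t}"
      and \<omega>: "\<omega> \<in> space M"
    have "(\<lambda>p. (p, \<omega>)) -` Q = {m. partial_sum X m \<omega> \<le> t} \<times> {m. partial_sum Y m \<omega> \<le> t}"
      using \<omega> by (auto simp: Q_def space_pair_measure)
    then show "emeasure (count_space UNIV) ((\<lambda>p. (p, \<omega>)) -` Q)
        = ennreal (real (partial_count X t \<omega>) * real (partial_count Y t \<omega>))"
      using fin by (simp add: emeasure_count_space partial_count_def card_cartesian_product
          ennreal_of_nat_eq_real_of_nat)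
  qed
  ultimately show ?thesis by simp
qed

text \<open>The rate \<open>l = 1 / (1 - r)\<close> is the one for which the remainder is a multiple
  of the Erlang mixture transform; on the square, \<open>(1 - r) * l = 1\<close> collapses the
  prefactor to \<open>r * t\<close>.\<close>

lemma joint_mass_correlated:
  assumes "r < 1" "0 < t"
  defines "z \<equiv> 2 * t / (1 - r)"
  shows "joint_mass t = t\<^sup>2 + r * t * (1 - exp (- z) * (bessel_I 0 z + bessel_I 1 z))"
proof -
  define l where "l = 1 / (1 - r)"
  have l: "0 < l" "l * (1 - r) = 1" using assms by (auto simp: l_def)
  have "renewal_laplace r a b = 1 / (a * b) + r * (1 - r) * (l\<^sup>2 / (l * (a + b) + a * b))" if "0 < a" "0 < b" for a b
  proof -
    have "a + b + (1 - r) * a * b = (1 - r) * (l * (a + b) + a * b)"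
      using l(2) by (simp add: distrib_left mult.assoc[symmetric] mult.commute[of _ l])
    moreover have "r * (1 - r) * (l\<^sup>2 / c) = r / ((1 - r) * c)" for c
      using assms(1) by (simp add: l_def power2_eq_square)
    ultimately show ?thesis by (simp only: renewal_laplace_def)
  qed
  from has_joint_laplace_square_add[OF joint_laplace_partial_sums quadrant_transform
      erlang_mixture_transform[OF l(1)] this less_imp_le[OF assms(2)]]
  have "joint_mass t = t\<^sup>2 + r * (1 - r) *
      (l * t * (1 - exp (- (2 * (l * t))) * (bessel_I 0 (2 * (l * t)) + bessel_I 1 (2 * (l * t)))))"
    unfolding joint_mass_def using assms l by (simp only: quadrant_square erlang_mixture_square less_imp_le)
  moreover have "2 * (l * t) = z" by (simp add: l_def z_def)
  moreover have "r * (1 - r) * (l * t * c) = r * t * c" for c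
    using l(2) by (simp add: mult_ac) 
  ultimately show ?thesis by simp
qed

text \<open>Applied with both coordinates at one site, this is the second moment of a single count,
  hence the source of the variance.\<close>

lemma joint_mass_identical:
  assumes "r = 1" "0 \<le> t"
  shows "joint_mass t = t\<^sup>2 + t"
proof -
  have "renewal_laplace r a b = 1 / (a * b) + 1 * (1 / (a + b))" for a b
    using assms(1) by (simp add: renewal_laplace_def)
  from has_joint_laplace_square_add[OF joint_laplace_partial_sums quadrant_transform half_line_transform
      this assms(2)]
  show ?thesis
    unfolding joint_mass_def using assms(2) by (simp only: quadrant_square half_line_square mult_1)
qed

end

text \<open>The basis of stationarity: it treats all lags alike, including those with
  \<open>r = 1\<close>.\<close>

lemma joint_mass_cong:
  assumes "bivariate_renewal M X Y r" "bivariate_renewal M' X' Y' r" "0 \<le> t"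
  shows "bivariate_renewal.joint_mass M X Y t = bivariate_renewal.joint_mass M' X' Y' t"
  unfolding bivariate_renewal.joint_mass_def[OF assms(1)] bivariate_renewal.joint_mass_def[OF assms(2)]
  using assms by (intro has_joint_laplace_square_eq[where L = "renewal_laplace r"]
      bivariate_renewal.joint_laplace_partial_sums)

section \<open>The Poisson random field\<close>

lemma random_field_measurable_restrict:
  assumes "random_field M A X"
  shows "(\<lambda>\<omega>. \<lambda>s\<in>A. X s \<omega>) \<in> M \<rightarrow>\<^sub>M PiM A (\<lambda>_. borel)"
  using assms by (intro measurable_restrict) (auto simp: random_field_def)

text \<open>Fields enter restricted to \<open>A\<close> because points of the product space are
  \<open>undefined\<close> outside \<open>A\<close>.\<close>

lemma nn_integral_field_law_cong:
  assumes "random_field M A X" "random_field M' A Z" "field_law M A X = field_law M' A Z"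
    and "F \<in> borel_measurable (PiM A (\<lambda>_. borel))"
  shows "(\<integral>\<^sup>+\<omega>. F (\<lambda>s\<in>A. X s \<omega>) \<partial>M) = (\<integral>\<^sup>+\<omega>. F (\<lambda>s\<in>A. Z s \<omega>) \<partial>M')"
proof -
  have "(\<integral>\<^sup>+f. F f \<partial>field_law M A X) = (\<integral>\<^sup>+\<omega>. F (\<lambda>s\<in>A. X s \<omega>) \<partial>M)"
    unfolding field_law_def using assms(4)
    by (intro nn_integral_distr random_field_measurable_restrict[OF assms(1)]) simp
  moreover have "(\<integral>\<^sup>+f. F f \<partial>field_law M' A Z) = (\<integral>\<^sup>+\<omega>. F (\<lambda>s\<in>A. Z s \<omega>) \<partial>M')"
    unfolding field_law_def using assms(4)
    by (intro nn_integral_distr random_field_measurable_restrict[OF assms(2)]) simp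
  ultimately show ?thesis by (simp only: assms(3))
qed

lemma AE_field_law_cong:
  assumes "random_field M A X" "random_field M' A Z" "field_law M A X = field_law M' A Z"
    and "{f \<in> space (PiM A (\<lambda>_. borel)). P f} \<in> sets (PiM A (\<lambda>_. borel))"
  shows "(AE \<omega> in M. P (\<lambda>s\<in>A. X s \<omega>)) \<longleftrightarrow> (AE \<omega> in M'. P (\<lambda>s\<in>A. Z s \<omega>))"
proof -
  have "(AE f in field_law M A X. P f) \<longleftrightarrow> (AE \<omega> in M. P (\<lambda>s\<in>A. X s \<omega>))"
    unfolding field_law_def
    by (rule AE_distr_iff[OF random_field_measurable_restrict[OF assms(1)] assms(4)])
  moreover have "(AE f in field_law M' A Z. P f) \<longleftrightarrow> (AE \<omega> in M'. P (\<lambda>s\<in>A. Z s \<omega>))"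
    unfolding field_law_def
    by (rule AE_distr_iff[OF random_field_measurable_restrict[OF assms(2)] assms(4)])
  ultimately show ?thesis by (simp only: assms(3))
qed

lemma measurable_component_PiM_borel:
  "s \<in> A \<Longrightarrow> (\<lambda>f. f s) \<in> borel_measurable (PiM A (\<lambda>_. borel :: real measure))"
  by (rule measurable_component_singleton)

section \<open>Moments and transforms of the Gaussian and exponential fields\<close>

lemma standard_gaussian_field_moments:
  fixes G :: "'p::ab_group_add \<Rightarrow> 'u \<Rightarrow> real"
  assumes G: "standard_gaussian_field M A \<rho> G" and A: "s \<in> A" "t \<in> A"
  shows "integrable M (G s)" "integral\<^sup>L M (G s) = 0"
    and "has_bochner_integral M (\<lambda>\<omega>. (G s \<omega>)\<^sup>2) 1"
    and "has_bochner_integral M (\<lambda>\<omega>. G s \<omega> * G t \<omega>) (\<rho> (s - t))"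
proof -
  have field: "random_field M A G" using G by (simp add: standard_gaussian_field_def gaussian_field_def)
  interpret prob_space M using field by (simp add: random_field_def)
  have [measurable]: "G x \<in> borel_measurable M" if "x \<in> A" for x
    using field that by (simp add: random_field_def)
  have sq: "integrable M (\<lambda>\<omega>. (G x \<omega>)\<^sup>2)" if "x \<in> A" for x
    using G that by (simp add: standard_gaussian_field_def weakly_stationary_def)
  show "integrable M (G s)" by (rule square_integrable_imp_integrable) (use sq A in auto)
  have mean: "integral\<^sup>L M (G x) = 0" and cov: "covariance M (G x) (G x) = 1" if "x \<in> A" for x
    using G that by (auto simp: standard_gaussian_field_def)
  from mean A show "integral\<^sup>L M (G s) = 0" by simp
  show "has_bochner_integral M (\<lambda>\<omega>. (G s \<omega>)\<^sup>2) 1"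
    using sq[OF A(1)] cov[OF A(1)] mean[OF A(1)]
    by (simp add: has_bochner_integral_iff covariance_def power2_eq_square)
  have "integrable M (\<lambda>\<omega>. G s \<omega> * G t \<omega>)"
  proof (rule Bochner_Integration.integrable_bound)
    show "integrable M (\<lambda>\<omega>. (G s \<omega>)\<^sup>2 + (G t \<omega>)\<^sup>2)" using sq A by auto
    show "AE \<omega> in M. norm (G s \<omega> * G t \<omega>) \<le> norm ((G s \<omega>)\<^sup>2 + (G t \<omega>)\<^sup>2)"
    proof (intro AE_I2)
      fix \<omega>
      have "2 * (\<bar>G s \<omega>\<bar> * \<bar>G t \<omega>\<bar>) \<le> (G s \<omega>)\<^sup>2 + (G t \<omega>)\<^sup>2"
        using sum_squares_bound[of "\<bar>G s \<omega>\<bar>" "\<bar>G t \<omega>\<bar>"] by (simp only: power2_abs mult.assoc)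
      moreover have "0 \<le> \<bar>G s \<omega>\<bar> * \<bar>G t \<omega>\<bar>" by simp
      ultimately show "norm (G s \<omega> * G t \<omega>) \<le> norm ((G s \<omega>)\<^sup>2 + (G t \<omega>)\<^sup>2)"
        unfolding real_norm_def abs_mult by linarith
    qed
  qed (use A in measurable)
  moreover have "correlation M (G s) (G t) = \<rho> (s - t)"
    using G A by (simp add: standard_gaussian_field_def)
  ultimately show "has_bochner_integral M (\<lambda>\<omega>. G s \<omega> * G t \<omega>) (\<rho> (s - t))"
    using cov A mean by (simp add: has_bochner_integral_iff correlation_def covariance_def)
qed

lemma standard_gaussian_field_second_moment:
  fixes G :: "'p::ab_group_add \<Rightarrow> 'u \<Rightarrow> real"
  assumes "standard_gaussian_field M A \<rho> G" "s \<in> A" "t \<in> A"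
  shows "has_bochner_integral M (\<lambda>\<omega>. (u * G s \<omega> + v * G t \<omega>)\<^sup>2) (u\<^sup>2 + 2 * \<rho> (s - t) * u * v + v\<^sup>2)"
proof -
  note moments = standard_gaussian_field_moments[OF assms(1)]
  have "has_bochner_integral M (\<lambda>\<omega>. u\<^sup>2 * (G s \<omega>)\<^sup>2 + 2 * u * v * (G s \<omega> * G t \<omega>) + v\<^sup>2 * (G t \<omega>)\<^sup>2)
      (u\<^sup>2 * 1 + 2 * u * v * \<rho> (s - t) + v\<^sup>2 * 1)"
    using assms(2,3) by (intro has_bochner_integral_add has_bochner_integral_mult_right moments)
  moreover have "(u * x + v * y)\<^sup>2 = u\<^sup>2 * x\<^sup>2 + 2 * u * v * (x * y) + v\<^sup>2 * y\<^sup>2" for x y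
    by (simp add: power2_eq_square algebra_simps)
  moreover have "u\<^sup>2 * 1 + 2 * u * v * \<rho> (s - t) + v\<^sup>2 * 1 = u\<^sup>2 + 2 * \<rho> (s - t) * u * v + v\<^sup>2"
    by simp
  ultimately show ?thesis by (simp only:)
qed

lemma standard_gaussian_field_rho_square_le_1:
  fixes G :: "'p::ab_group_add \<Rightarrow> 'u \<Rightarrow> real"
  assumes "standard_gaussian_field M A \<rho> G" "s \<in> A" "t \<in> A"
  shows "(\<rho> (s - t))\<^sup>2 \<le> 1"
proof -
  \<comment> \<open>The residual of the regression of \<open>G t\<close> on \<open>G s\<close> has
    variance \<open>1 - \<rho>\<^sup>2\<close>.\<close>
  have "0 \<le> (\<integral>\<omega>. (- \<rho> (s - t) * G s \<omega> + 1 * G t \<omega>)\<^sup>2 \<partial>M)" by simp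
  also have "\<dots> = 1 - (\<rho> (s - t))\<^sup>2"
    by (subst has_bochner_integral_integral_eq[OF standard_gaussian_field_second_moment[OF assms]])
      (simp add: power2_eq_square)
  finally show ?thesis by simp
qed

lemma standard_gaussian_field_rho_0:
  fixes G :: "'p::ab_group_add \<Rightarrow> 'u \<Rightarrow> real"
  assumes "standard_gaussian_field M A \<rho> G" "s \<in> A"
  shows "\<rho> (s - s) = 1"
proof -
  have "\<rho> (s - s) = integral\<^sup>L M (\<lambda>\<omega>. (G s \<omega>)\<^sup>2)"
    using standard_gaussian_field_moments(4)[OF assms assms(2)]
    by (simp add: has_bochner_integral_iff power2_eq_square)
  also have "\<dots> = 1"
    by (rule has_bochner_integral_integral_eq) (rule standard_gaussian_field_moments(3)[OF assms assms(2)])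
  finally show ?thesis .
qed

text \<open>The square root reflects a single Gaussian copy; two independent copies multiply to the
  full transform.\<close>

lemma standard_gaussian_field_laplace_squares:
  fixes G :: "'p::ab_group_add \<Rightarrow> 'u \<Rightarrow> real"
  assumes G: "standard_gaussian_field M A \<rho> G" and A: "s \<in> A" "t \<in> A" and "0 \<le> a" "0 \<le> b"
  shows "(\<integral>\<^sup>+\<omega>. ennreal (exp (- (a * (G s \<omega>)\<^sup>2 / 2)) * exp (- (b * (G t \<omega>)\<^sup>2 / 2))) \<partial>M)
    = ennreal (sqrt (bivariate_exp_laplace ((\<rho> (s - t))\<^sup>2) a b))"
proof -
  have field: "random_field M A G" using G by (simp add: standard_gaussian_field_def gaussian_field_def)
  interpret prob_space M using field by (simp add: random_field_def)
  have [measurable]: "G s \<in> borel_measurable M" "G t \<in> borel_measurable M"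
    using field A by (auto simp: random_field_def)
  have gaussian: "gaussian_rv M (\<lambda>\<omega>. \<Sum>x\<in>F. c x * G x \<omega>)" if "finite F" "F \<subseteq> A" for F c
    using G that by (auto simp: standard_gaussian_field_def gaussian_field_def)
  have pair: "gaussian_rv M (\<lambda>\<omega>. u * G s \<omega> + v * G t \<omega>)" for u v
  \<comment> \<open>Linear combinations are indexed by sets of sites, so coinciding sites must merge
    their coefficients.\<close>
  proof (cases "s = t")
    case True
    then show ?thesis using gaussian[of "{s}" "\<lambda>_. u + v"] A by (simp add: distrib_right)
  next
    case False
    then show ?thesis using gaussian[of "{s, t}" "\<lambda>x. if x = s then u else v"] A by simp
  qed
  have "expectation (\<lambda>\<omega>. cos (u * G s \<omega> + v * G t \<omega>))
      = exp (- (u\<^sup>2 + 2 * \<rho> (s - t) * u * v + v\<^sup>2) / 2)" for u v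
  proof (rule gaussian_rv_expectation_cos[OF pair])
    show "expectation (\<lambda>\<omega>. u * G s \<omega> + v * G t \<omega>) = 0"
      using standard_gaussian_field_moments(1,2)[OF G A(1) A(1)]
        standard_gaussian_field_moments(1,2)[OF G A(2) A(2)] by simp
    show "expectation (\<lambda>\<omega>. (u * G s \<omega> + v * G t \<omega>)\<^sup>2) = u\<^sup>2 + 2 * \<rho> (s - t) * u * v + v\<^sup>2"
      by (rule has_bochner_integral_integral_eq) (rule standard_gaussian_field_second_moment[OF G A])
  qed
  then have "expectation (\<lambda>\<omega>. exp (- (a * (G s \<omega>)\<^sup>2 / 2)) * exp (- (b * (G t \<omega>)\<^sup>2 / 2)))
      = 1 / sqrt ((1 + a) * (1 + b) - (\<rho> (s - t))\<^sup>2 * a * b)"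
    using assms(4,5) standard_gaussian_field_rho_square_le_1[OF G A]
    by (intro gaussian_pair_laplace_squares) auto
  moreover have "integrable M (\<lambda>\<omega>. exp (- (a * (G s \<omega>)\<^sup>2 / 2)) * exp (- (b * (G t \<omega>)\<^sup>2 / 2)))"
    using assms(4,5) by (intro integrable_const_bound[where B=1]) (auto intro!: mult_le_one)
  ultimately show ?thesis
    by (subst nn_integral_eq_integral) (auto simp: bivariate_exp_laplace_def real_sqrt_divide)
qed

text \<open>The factor \<open>l\<close> cancels the rate and leaves half a sum of squares;
  independence of \<open>GG 1\<close> and \<open>GG 2\<close> squares the transform of one
  copy.\<close>

lemma exponential_field_laplace:
  fixes G :: "'p::ab_group_add \<Rightarrow> 'u \<Rightarrow> real" and GG :: "nat \<Rightarrow> 'p \<Rightarrow> 'v \<Rightarrow> real"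
  assumes G: "standard_gaussian_field M0 A \<rho> G" and GG: "independent_copies M1 {1, 2} A GG M0 G"
    and A: "s \<in> A" "t \<in> A" and ab: "0 \<le> a" "0 \<le> b"
    and l: "0 < l" "rate s = l" "rate t = l"
  shows "(\<integral>\<^sup>+\<omega>. ennreal (exp (- (a * (l * exponential_field rate (GG 1) (GG 2) s \<omega>)
      + b * (l * exponential_field rate (GG 1) (GG 2) t \<omega>)))) \<partial>M1)
    = ennreal (bivariate_exp_laplace ((\<rho> (s - t))\<^sup>2) a b)"
proof -
  let ?\<phi> = "bivariate_exp_laplace ((\<rho> (s - t))\<^sup>2) a b"
  have field: "random_field M0 A G" "random_field M1 A (GG 1)" "random_field M1 A (GG 2)"
    and law: "\<And>i. i \<in> {1, 2} \<Longrightarrow> random_field M1 A (GG i)"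
      "\<And>i. i \<in> {1, 2} \<Longrightarrow> field_law M1 A (GG i) = field_law M0 A G"
    and indep: "prob_space.indep_vars M1 (\<lambda>_. PiM A (\<lambda>_. borel)) (\<lambda>i \<omega>. \<lambda>s\<in>A. GG i s \<omega>) {1, 2}"
    using GG by (auto simp: independent_copies_def)
  interpret prob_space M1 using field(2) by (simp add: random_field_def)
  define F :: "('p \<Rightarrow> real) \<Rightarrow> ennreal"
    where "F f = ennreal (exp (- (a * (f s)\<^sup>2 / 2)) * exp (- (b * (f t)\<^sup>2 / 2)))" for f
  note [measurable] = measurable_component_PiM_borel[OF A(1)] measurable_component_PiM_borel[OF A(2)]
  have F [measurable]: "F \<in> borel_measurable (PiM A (\<lambda>_. borel))"
    unfolding F_def by measurable
  have single: "(\<integral>\<^sup>+\<omega>. F (\<lambda>s\<in>A. GG i s \<omega>) \<partial>M1) = ennreal (sqrt ?\<phi>)" if "i \<in> {1, 2}" for i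
  proof -
    have "(\<integral>\<^sup>+\<omega>. F (\<lambda>s\<in>A. GG i s \<omega>) \<partial>M1) = (\<integral>\<^sup>+\<omega>. F (\<lambda>s\<in>A. G s \<omega>) \<partial>M0)"
      by (rule nn_integral_field_law_cong[OF law(1)[OF that] field(1) law(2)[OF that] F])
    also have "\<dots> = ennreal (sqrt ?\<phi>)"
      using standard_gaussian_field_laplace_squares[OF G A ab] A by (simp add: F_def)
    finally show ?thesis .
  qed
  have factor: "(\<Prod>i\<in>{1, 2}. F (\<lambda>s\<in>A. GG i s \<omega>)) = ennreal (exp (- (a * (l * exponential_field rate (GG 1) (GG 2) s \<omega>)
      + b * (l * exponential_field rate (GG 1) (GG 2) t \<omega>))))" for \<omega>
  proof -
    have "a * (l * exponential_field rate (GG 1) (GG 2) s \<omega>) + b * (l * exponential_field rate (GG 1) (GG 2) t \<omega>)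
        = (a * (GG 1 s \<omega>)\<^sup>2 / 2 + b * (GG 1 t \<omega>)\<^sup>2 / 2) + (a * (GG 2 s \<omega>)\<^sup>2 / 2 + b * (GG 2 t \<omega>)\<^sup>2 / 2)"
      using l by (simp add: exponential_field_def algebra_simps add_divide_distrib)
    then show ?thesis
      using A by (simp add: F_def ennreal_mult'[symmetric] mult_exp_exp)
  qed
  have "(\<integral>\<^sup>+\<omega>. (\<Prod>i\<in>{1, 2}. F (\<lambda>s\<in>A. GG i s \<omega>)) \<partial>M1) = (\<Prod>i\<in>{1, 2}. \<integral>\<^sup>+\<omega>. F (\<lambda>s\<in>A. GG i s \<omega>) \<partial>M1)"
    by (intro indep_vars_nn_integral indep_vars_compose2[OF indep] F) simp_all
  also have "\<dots> = (\<Prod>i\<in>{1, 2::nat}. ennreal (sqrt ?\<phi>))"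
    by (intro prod.cong single) auto
  also have "\<dots> = ennreal (sqrt ?\<phi>) * ennreal (sqrt ?\<phi>)"
    by simp
  also have "\<dots> = ennreal ?\<phi>"
  proof -
    have "0 \<le> ?\<phi>"
      by (intro bivariate_exp_laplace_nonneg standard_gaussian_field_rho_square_le_1[OF G A] ab)
    then show ?thesis by (subst ennreal_mult[symmetric]) simp_all
  qed
  finally show ?thesis unfolding factor .
qed

text \<open>Independence of whole fields passes to pairs of values under a measurable map; sign and
  transform are inherited from the law of the exponential field. Scaling by \<open>l\<close> moves
  the time horizon from 1 to \<open>l\<close>.\<close>

lemma bivariate_renewal_copies:
  fixes G :: "'p::ab_group_add \<Rightarrow> 'u \<Rightarrow> real" and GG :: "nat \<Rightarrow> 'p \<Rightarrow> 'v \<Rightarrow> real"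
    and Y :: "nat \<Rightarrow> 'p \<Rightarrow> 'w \<Rightarrow> real"
  assumes field: "poisson_random_field M0 G M1 GG M Y A \<rho> rate N"
    and A: "s \<in> A" "t \<in> A" and rate: "rate s = l" "rate t = l"
  shows "bivariate_renewal M (\<lambda>i \<omega>. l * Y i s \<omega>) (\<lambda>i \<omega>. l * Y i t \<omega>) ((\<rho> (s - t))\<^sup>2)"
proof -
  let ?W = "exponential_field rate (GG 1) (GG 2)"
  have G: "standard_gaussian_field M0 A \<rho> G" and GG: "independent_copies M1 {1, 2} A GG M0 G"
    and Y: "independent_copies M {1..} A Y M1 ?W" and l: "0 < l"
    using field rate A by (auto simp: poisson_random_field_def)
  have law: "random_field M1 A ?W" "\<And>i. 1 \<le> i \<Longrightarrow> random_field M A (Y i)"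
      "\<And>i. 1 \<le> i \<Longrightarrow> field_law M A (Y i) = field_law M1 A ?W"
    and indep: "prob_space.indep_vars M (\<lambda>_. PiM A (\<lambda>_. borel)) (\<lambda>i \<omega>. \<lambda>s\<in>A. Y i s \<omega>) {1..}"
    using Y by (auto simp: independent_copies_def)
  interpret prob_space M using law(2)[of 1] by (simp add: random_field_def)
  note [measurable] = measurable_component_PiM_borel[OF A(1)] measurable_component_PiM_borel[OF A(2)]
  show ?thesis
  proof
    have "indep_vars (\<lambda>_. borel \<Otimes>\<^sub>M borel)
        (\<lambda>i \<omega>. (\<lambda>f. (l * f s, l * f t)) (\<lambda>s\<in>A. Y i s \<omega>)) {1..}"
      by (rule indep_vars_compose2[OF indep]) measurable
    then show "indep_vars (\<lambda>_. borel \<Otimes>\<^sub>M borel) (\<lambda>i \<omega>. (l * Y i s \<omega>, l * Y i t \<omega>)) {1..}"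
      using A by simp
  next
    fix i :: nat assume i: "1 \<le> i"
    have "AE \<omega> in M1. 0 \<le> l * (\<lambda>s\<in>A. ?W s \<omega>) s \<and> 0 \<le> l * (\<lambda>s\<in>A. ?W s \<omega>) t"
      using A l rate by (simp add: exponential_field_def)
    then show "AE \<omega> in M. 0 \<le> l * Y i s \<omega> \<and> 0 \<le> l * Y i t \<omega>"
      using AE_field_law_cong[OF law(2)[OF i] law(1) law(3)[OF i], of "\<lambda>f. 0 \<le> l * f s \<and> 0 \<le> l * f t"] A
      by simp
    fix a b :: real assume ab: "0 \<le> a" "0 \<le> b"
    have "(\<integral>\<^sup>+\<omega>. ennreal (exp (- (a * (l * (\<lambda>s\<in>A. Y i s \<omega>) s) + b * (l * (\<lambda>s\<in>A. Y i s \<omega>) t)))) \<partial>M)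
        = (\<integral>\<^sup>+\<omega>. ennreal (exp (- (a * (l * (\<lambda>s\<in>A. ?W s \<omega>) s) + b * (l * (\<lambda>s\<in>A. ?W s \<omega>) t)))) \<partial>M1)"
      by (rule nn_integral_field_law_cong[OF law(2)[OF i] law(1) law(3)[OF i]]) measurable
    then show "(\<integral>\<^sup>+\<omega>. ennreal (exp (- (a * (l * Y i s \<omega>) + b * (l * Y i t \<omega>)))) \<partial>M)
        = ennreal (bivariate_exp_laplace ((\<rho> (s - t))\<^sup>2) a b)"
      using A exponential_field_laplace[OF G GG A ab l rate] by simp
  qed (use standard_gaussian_field_rho_square_le_1[OF G A] in auto)
qed

section \<open>From renewal counts to moments of the Poisson field\<close>

lemma finite_down_closed_nat:
  fixes D :: "nat set"
  assumes "finite D" "\<And>m n. n \<in> D \<Longrightarrow> m \<le> n \<Longrightarrow> m \<in> D"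
  obtains n where "D = {..<n}"
proof (cases "D = {}")
  case True
  with that[of 0] show ?thesis by simp
next
  case False
  have "D = {..Max D}"
    using assms(2)[OF Max_in[OF assms(1) False]] Max_ge[OF assms(1)] by blast
  with that[of "Suc (Max D)"] show ?thesis by (simp add: lessThan_Suc_atMost)
qed

text \<open>Nonnegative increments make the admissible indices an initial segment, where maximum and
  cardinality agree. Finiteness excludes the unspecified value of \<open>Max\<close>.\<close>

lemma renewal_count_eq_partial_count:
  assumes "0 < l" and nonneg: "\<And>i. 1 \<le> i \<Longrightarrow> 0 \<le> Y i s \<omega>"
    and fin: "finite {m. partial_sum (\<lambda>i \<omega>. l * Y i s \<omega>) m \<omega> \<le> l}"
  shows "renewal_count Y s \<omega> = partial_count (\<lambda>i \<omega>. l * Y i s \<omega>) l \<omega>"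
proof -
  define D where "D = {m. renewal_sum Y (Suc m) s \<omega> \<le> 1}"
  have "partial_sum (\<lambda>i \<omega>. l * Y i s \<omega>) m \<omega> = l * renewal_sum Y (Suc m) s \<omega>" for m
    by (simp only: partial_sum_def renewal_sum_def sum_distrib_left)
  then have D: "{m. partial_sum (\<lambda>i \<omega>. l * Y i s \<omega>) m \<omega> \<le> l} = D"
    using assms(1) by (simp add: D_def)
  have mono: "renewal_sum Y m s \<omega> \<le> renewal_sum Y n s \<omega>" if "m \<le> n" for m n
    unfolding renewal_sum_def using that nonneg by (intro sum_mono2) auto
  obtain n where n: "D = {..<n}"
  proof (rule finite_down_closed_nat)
    show "finite D" using fin D by simp
    show "m \<in> D" if "n \<in> D" "m \<le> n" for m n
      using that mono[of "Suc m" "Suc n"] by (auto simp: D_def)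
  qed
  have "renewal_count Y s \<omega> = n"
  proof (cases "renewal_sum Y 1 s \<omega> > 1")
    case True
    then have "0 \<notin> D" by (simp add: D_def)
    with n have "n = 0" by simp
    with True show ?thesis by (simp add: renewal_count_def)
  next
    case False
    then have "0 \<in> D" by (simp add: D_def)
    with n have "0 < n" by simp
    have "{k. k \<ge> 1 \<and> renewal_sum Y k s \<omega> \<le> 1} = Suc ` D"
    proof (intro set_eqI iffI)
      fix k assume "k \<in> {k. k \<ge> 1 \<and> renewal_sum Y k s \<omega> \<le> 1}"
      then show "k \<in> Suc ` D" by (cases k) (auto simp: D_def)
    qed (auto simp: D_def)
    also have "\<dots> = {1..n}"
      unfolding n image_Suc_lessThan by auto
    finally have "renewal_count Y s \<omega> = Max {1..n}"
      using False by (simp only: renewal_count_def if_False)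
    also have "Max {1..n} = n"
      using \<open>0 < n\<close> by (intro Max_eqI) auto
    finally show ?thesis .
  qed
  then show ?thesis by (simp add: partial_count_def D n)
qed

lemma borel_measurable_renewal_count:
  assumes "\<And>i. 1 \<le> i \<Longrightarrow> Y i s \<in> borel_measurable M"
  shows "(\<lambda>\<omega>. real (renewal_count Y s \<omega>)) \<in> borel_measurable M"
proof -
  have [measurable]: "renewal_sum Y n s \<in> borel_measurable M" for n
    unfolding renewal_sum_def[abs_def] using assms by (intro borel_measurable_sum) auto
  have "renewal_count Y s \<in> M \<rightarrow>\<^sub>M count_space UNIV"
    unfolding renewal_count_def[abs_def] by measurable
  then show ?thesis by measurable
qed

text \<open>Almost surely the count at a site is a \<open>partial_count\<close> with horizon
  \<open>l\<close>, so its moments are masses of the renewal measures.\<close>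

lemma poisson_random_field_moments:
  fixes G :: "'p::ab_group_add \<Rightarrow> 'u \<Rightarrow> real" and GG :: "nat \<Rightarrow> 'p \<Rightarrow> 'v \<Rightarrow> real"
    and Y :: "nat \<Rightarrow> 'p \<Rightarrow> 'w \<Rightarrow> real"
  assumes field: "poisson_random_field M0 G M1 GG M Y A \<rho> rate N"
    and A: "s \<in> A" "t \<in> A" and rate: "rate s = l" "rate t = l" and l: "0 < l"
  shows "(\<lambda>\<omega>. real (N s \<omega>)) \<in> borel_measurable M"
    and "has_bochner_integral M (\<lambda>\<omega>. real (N s \<omega>)) l"
    and "has_bochner_integral M (\<lambda>\<omega>. real (N s \<omega>) * real (N t \<omega>))
      (bivariate_renewal.joint_mass M (\<lambda>i \<omega>. l * Y i s \<omega>) (\<lambda>i \<omega>. l * Y i t \<omega>) l)"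
proof -
  let ?X = "\<lambda>s i \<omega>. l * Y i s \<omega>"
  have Y: "random_field M A (Y i)" if "1 \<le> i" for i
    using field that by (auto simp: poisson_random_field_def independent_copies_def)
  have meas: "(\<lambda>\<omega>. real (N x \<omega>)) \<in> borel_measurable M"
    and count: "AE \<omega> in M. real (N x \<omega>) = real (partial_count (?X x) l \<omega>)"
    if x: "x \<in> A" "rate x = l" for x
  proof -
    have N: "N x \<omega> = renewal_count Y x \<omega>" if "\<omega> \<in> space M" for \<omega>
      using field that x by (auto simp: poisson_random_field_def)
    have "(\<lambda>\<omega>. real (renewal_count Y x \<omega>)) \<in> borel_measurable M"
      using Y x by (intro borel_measurable_renewal_count) (auto simp: random_field_def)
    then show "(\<lambda>\<omega>. real (N x \<omega>)) \<in> borel_measurable M"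
      using N by (simp cong: measurable_cong)
    interpret R: bivariate_renewal M "?X x" "?X x" "(\<rho> (x - x))\<^sup>2"
      by (rule bivariate_renewal_copies[OF field x(1) x(1) x(2) x(2)])
    have "AE \<omega> in M. \<forall>i\<in>{1..}. 0 \<le> l * Y i x \<omega> \<and> 0 \<le> l * Y i x \<omega>"
      using R.nonneg by (subst AE_ball_countable) auto
    with R.AE_finite_partial_sum_le(1)[OF less_imp_le[OF l]] AE_space
    show "AE \<omega> in M. real (N x \<omega>) = real (partial_count (?X x) l \<omega>)"
    proof eventually_elim
      fix \<omega>
      assume *: "finite {m. partial_sum (?X x) m \<omega> \<le> l}" "\<omega> \<in> space M"
        "\<forall>i\<in>{1..}. 0 \<le> l * Y i x \<omega> \<and> 0 \<le> l * Y i x \<omega>"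
      then have "0 \<le> Y i x \<omega>" if "1 \<le> i" for i
        using that l by (auto simp: zero_le_mult_iff)
      then show "real (N x \<omega>) = real (partial_count (?X x) l \<omega>)"
        using renewal_count_eq_partial_count[where Y = Y and s = x and \<omega> = \<omega>, OF l _ *(1)] N[OF *(2)] by simp
    qed
  qed
  interpret R: bivariate_renewal M "?X s" "?X t" "(\<rho> (s - t))\<^sup>2"
    by (rule bivariate_renewal_copies[OF field A rate])
  note meas_s = meas[OF A(1) rate(1)] and meas_t = meas[OF A(2) rate(2)]
  show "(\<lambda>\<omega>. real (N s \<omega>)) \<in> borel_measurable M" by (rule meas_s)
  have "(\<integral>\<^sup>+\<omega>. ennreal (real (N s \<omega>)) \<partial>M) = (\<integral>\<^sup>+\<omega>. ennreal (real (partial_count (?X s) l \<omega>)) \<partial>M)"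
    by (rule nn_integral_cong_AE, use count[OF A(1) rate(1)] in eventually_elim) simp
  also have "\<dots> = ennreal l"
    using l by (intro R.AE_finite_partial_sum_le(2)) auto
  finally show "has_bochner_integral M (\<lambda>\<omega>. real (N s \<omega>)) l"
    using l meas_s by (intro has_bochner_integral_nn_integral) auto
  have "(\<integral>\<^sup>+\<omega>. ennreal (real (N s \<omega>) * real (N t \<omega>)) \<partial>M)
      = (\<integral>\<^sup>+\<omega>. ennreal (real (partial_count (?X s) l \<omega>) * real (partial_count (?X t) l \<omega>)) \<partial>M)"
    by (rule nn_integral_cong_AE, use count[OF A(1) rate(1)] count[OF A(2) rate(2)] in eventually_elim) simp
  also have "\<dots> = ennreal (R.joint_mass l)"
    using l by (intro R.nn_integral_partial_count_mult) auto
  finally show "has_bochner_integral M (\<lambda>\<omega>. real (N s \<omega>) * real (N t \<omega>)) (R.joint_mass l)"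
    using meas_s meas_t
    by (intro has_bochner_integral_nn_integral) (auto simp: R.joint_mass_def)
qed

lemma covariance_poisson_random_field:
  fixes G :: "'p::ab_group_add \<Rightarrow> 'u \<Rightarrow> real" and GG :: "nat \<Rightarrow> 'p \<Rightarrow> 'v \<Rightarrow> real"
    and Y :: "nat \<Rightarrow> 'p \<Rightarrow> 'w \<Rightarrow> real"
  assumes field: "poisson_random_field M0 G M1 GG M Y A \<rho> rate N"
    and A: "s \<in> A" "t \<in> A" and rate: "rate s = l" "rate t = l" and l: "0 < l"
  shows "covariance M (\<lambda>\<omega>. real (N s \<omega>)) (\<lambda>\<omega>. real (N t \<omega>))
    = bivariate_renewal.joint_mass M (\<lambda>i \<omega>. l * Y i s \<omega>) (\<lambda>i \<omega>. l * Y i t \<omega>) l - l\<^sup>2"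
proof -
  interpret R: bivariate_renewal M "\<lambda>i \<omega>. l * Y i s \<omega>" "\<lambda>i \<omega>. l * Y i t \<omega>" "(\<rho> (s - t))\<^sup>2"
    by (rule bivariate_renewal_copies[OF field A rate])
  note s = poisson_random_field_moments(2)[OF field A(1) A(1) rate(1) rate(1) l]
    and t = poisson_random_field_moments(2)[OF field A(2) A(2) rate(2) rate(2) l]
    and st = poisson_random_field_moments(3)[OF field A rate l]
  have "has_bochner_integral M (\<lambda>\<omega>. real (N s \<omega>) * real (N t \<omega>) - l * real (N t \<omega>) - (l * real (N s \<omega>) - l\<^sup>2))
      (R.joint_mass l - l * l - (l * l - l\<^sup>2))"
    by (intro has_bochner_integral_diff has_bochner_integral_mult_right s t st)
      (simp add: R.prob_space has_bochner_integral_iff)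
  moreover have "real (N s \<omega>) * real (N t \<omega>) - l * real (N t \<omega>) - (l * real (N s \<omega>) - l\<^sup>2)
      = (real (N s \<omega>) - l) * (real (N t \<omega>) - l)" for \<omega>
    by (simp add: power2_eq_square algebra_simps)
  moreover have "(\<integral>\<omega>. real (N s \<omega>) \<partial>M) = l" "(\<integral>\<omega>. real (N t \<omega>) \<partial>M) = l"
    using s t by (auto intro: has_bochner_integral_integral_eq)
  ultimately show ?thesis
    by (simp add: covariance_def has_bochner_integral_iff power2_eq_square)
qed

theorem corollary1:
  fixes A :: "(real ^ 'd) set"
    and \<rho> :: "real ^ 'd \<Rightarrow> real"
    and rate :: "real ^ 'd \<Rightarrow> real"
    and l :: real
    and M0 :: "'u measure" and G :: "real ^ 'd \<Rightarrow> 'u \<Rightarrow> real"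
    and M1 :: "'v measure" and GG :: "nat \<Rightarrow> real ^ 'd \<Rightarrow> 'v \<Rightarrow> real"
    and M :: "'w measure" and Y :: "nat \<Rightarrow> real ^ 'd \<Rightarrow> 'w \<Rightarrow> real"
    and N :: "real ^ 'd \<Rightarrow> 'w \<Rightarrow> nat"
  assumes field: "poisson_random_field M0 G M1 GG M Y A \<rho> rate N"
    and l_pos: "l > 0"
    and const: "\<forall>s\<in>A. rate s = l"
  shows "weakly_stationary M A (\<lambda>s \<omega>. real (N s \<omega>)) \<and>
    (\<forall>s\<in>A. \<forall>t\<in>A. \<bar>\<rho> (s - t)\<bar> < 1 \<longrightarrow>
      (let z = 2 * l / (1 - (\<rho> (s - t))\<^sup>2) in
       correlation M (\<lambda>\<omega>. real (N s \<omega>)) (\<lambda>\<omega>. real (N t \<omega>)) =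
       (\<rho> (s - t))\<^sup>2 * (1 - exp (- z) * (bessel_I 0 z + bessel_I 1 z))))"
proof
  let ?cov = "\<lambda>s t. covariance M (\<lambda>\<omega>. real (N s \<omega>)) (\<lambda>\<omega>. real (N t \<omega>))"
  have G: "standard_gaussian_field M0 A \<rho> G"
    using field by (simp add: poisson_random_field_def)
  have Y: "random_field M A (Y 1)"
    using field by (auto simp: poisson_random_field_def independent_copies_def)
  have rate: "rate s = l" if "s \<in> A" for s using const that by simp
  note moments = poisson_random_field_moments[OF field _ _ rate rate l_pos]
  note cov = covariance_poisson_random_field[OF field _ _ rate rate l_pos]
  \<comment> \<open>Equal lags have equal \<open>\<rho>\<close>, hence renewal pairs with the same
    parameter and the same joint mass.\<close>
  have cov_cong: "?cov s t = ?cov s' t'"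
    if "s \<in> A" "t \<in> A" "s' \<in> A" "t' \<in> A" "s - t = s' - t'" for s t s' t'
  proof -
    have "bivariate_renewal M (\<lambda>i \<omega>. l * Y i s' \<omega>) (\<lambda>i \<omega>. l * Y i t' \<omega>) ((\<rho> (s - t))\<^sup>2)"
      using bivariate_renewal_copies[OF field that(3,4) rate rate] that by simp
    from joint_mass_cong[OF bivariate_renewal_copies[OF field that(1,2) rate rate] this less_imp_le[OF l_pos]]
    show ?thesis using that by (simp add: cov)
  qed
  \<comment> \<open>A constant is chosen for each lag and these constants form \<open>C\<close>;
    lags that do not occur get an arbitrary value.\<close>
  then have "\<forall>h. \<exists>c. \<forall>s\<in>A. \<forall>t\<in>A. s - t = h \<longrightarrow> ?cov s t = c" by metis
  then have "\<exists>C. \<forall>s\<in>A. \<forall>t\<in>A. ?cov s t = C (s - t)" by metis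
  then show "weakly_stationary M A (\<lambda>s \<omega>. real (N s \<omega>))"
    using Y moments(1) has_bochner_integral_integral_eq[OF moments(2)] moments(3)
    unfolding weakly_stationary_def random_field_def
    by (auto simp: has_bochner_integral_iff power2_eq_square)
  show "\<forall>s\<in>A. \<forall>t\<in>A. \<bar>\<rho> (s - t)\<bar> < 1 \<longrightarrow>
      (let z = 2 * l / (1 - (\<rho> (s - t))\<^sup>2) in
       correlation M (\<lambda>\<omega>. real (N s \<omega>)) (\<lambda>\<omega>. real (N t \<omega>)) =
       (\<rho> (s - t))\<^sup>2 * (1 - exp (- z) * (bessel_I 0 z + bessel_I 1 z)))"
  proof (intro ballI impI)
    fix s t assume A: "s \<in> A" "t \<in> A" and \<rho>: "\<bar>\<rho> (s - t)\<bar> < 1"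
    \<comment> \<open>At a single site \<open>r = 1\<close>, so the second moment is
      \<open>l\<^sup>2 + l\<close> and the variance \<open>l\<close> is the denominator of the
      correlation.\<close>
    have var: "?cov x x = l" if x: "x \<in> A" for x
    proof -
      have "(\<rho> (x - x))\<^sup>2 = 1" using standard_gaussian_field_rho_0[OF G x] by simp
      from bivariate_renewal.joint_mass_identical[OF bivariate_renewal_copies[OF field x x rate rate] this]
      show ?thesis using x l_pos cov[OF x x] by simp
    qed
    have "(\<rho> (s - t))\<^sup>2 < 1" using \<rho> by (simp add: abs_square_less_1)
    from bivariate_renewal.joint_mass_correlated[OF bivariate_renewal_copies[OF field A rate rate] this l_pos] A
    show "let z = 2 * l / (1 - (\<rho> (s - t))\<^sup>2) in
       correlation M (\<lambda>\<omega>. real (N s \<omega>)) (\<lambda>\<omega>. real (N t \<omega>)) =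
       (\<rho> (s - t))\<^sup>2 * (1 - exp (- z) * (bessel_I 0 z + bessel_I 1 z))"
      using l_pos by (simp add: Let_def correlation_def var cov)
  qed
qed

end
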